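(* Let $\mathfrak{k}$ be a field and $q\in\mathfrak{k}$, $q\neq 0$. For $a,b\in\mathbb{Z}_{\ge 0}$ put $p_{a,b}:=P_{a,b}(1,q^{-2})\in\mathfrak{k}B_{a+b}$, and for $a,b,c\in\mathbb{Z}_{\geq 0}$ with $c\le b$ put $$A(a,b;c):=q^{1-a-c}\ S_{b-c,c}^{\uparrow a}\ \beta_{a,c}\ p_{a,b-c}^{\uparrow c}\ \in\ \mathfrak{k}B_{a+b}.$$ Then these elements satisfy the system (the "universal" form of the Yang--Baxter equation on the tensor space): for all $a,b,c,e,f\in\mathbb{Z}_{\geq 0}$, $$\sum_{i=e}^{\min(c,\,b+c-f)}A(b,c;i)^{\uparrow a}\,A(a,i;e)\,A(a+i-e,\,b+c-i;\,f)^{\uparrow e}=\sum_{j=\max(0,\,f+e-c)}^{\min(f,\,b)}A(a,b;j)\,A(a+b-j,\,c;\,f+e-j)^{\uparrow j}\,A(j,\,f+e-j;\,e)$$ in the group algebra $\mathfrak{k}B_\infty$ (a sum over an empty range is $0$).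
   Context: Braid groups: $B_{n+1}$ is generated by $\sigma_1,\dots,\sigma_n$ with relations $\sigma_i\sigma_j\sigma_i=\sigma_j\sigma_i\sigma_j$ if $|i-j|=1$ and $\sigma_i\sigma_j=\sigma_j\sigma_i$ if $|i-j|>1$; $B_0$ and $B_1$ are trivial. The inclusions $B_n\subset B_{n+1}$ are $\sigma_i\mapsto\sigma_i$, and $B_\infty=\varinjlim B_n$. For $\ell\in\mathbb{Z}_{\ge0}$, $w\mapsto w^{\uparrow\ell}$ is the endomorphism of $B_\infty$ (extended linearly to group algebras) sending $\sigma_i$ to $\sigma_{i+\ell}$ for all $i\geq 1$. Elements $\beta_{k,l}\in B_{k+l}$ for $k,l\in\mathbb{Z}_{\ge0}$: $\beta_{k,l}=(\sigma_k\sigma_{k+1}\cdots\sigma_{k+l-1})(\sigma_{k-1}\sigma_k\cdots\sigma_{k+l-2})\cdots(\sigma_1\sigma_2\cdots\sigma_l)$, with $\beta_{k,0}=\beta_{0,l}=1$. Equivalently $\beta_{k,l}=(\sigma_k\sigma_{k-1}\cdots\sigma_1)(\sigma_{k+1}\sigma_k\cdots\sigma_2)\cdots(\sigma_{k+l-1}\cdots\sigma_l)$. In particular $\beta_{k,1}=\sigma_k\sigma_{k-1}\cdots\sigma_1$. Braid shuffle elements $S_{m,n}\in\mathfrak{k}B_{m+n}$ (integers $m,n$ with $m+n\ge0$): $S_{0,0}=1$; $S_{m,n}=0$ if $m<0$ or $n<0$; and for $m,n\ge0$, $m+n\geq 1$, $S_{m,n}=S_{m-1,n}+S_{m,n-1}\,\beta_{m,1}^{\uparrow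 n-1}$ (the second term is $0$ when $n=0$, the first is $0$ when $m=0$). In particular $S_{0,n}=S_{n,0}=1$ for $n\ge 0$. Braid Pochhammer symbols: $P_{k,n}(x,y):=(x-\beta_{k,1}y)(x-\beta_{k+1,1}y)\cdots(x-\beta_{k+n-1,1}y)$ for $k,n\in\mathbb{Z}_{\ge0}$ and scalars $x,y$ (the product taken in this order; $P_{k,0}=1$). *)

theory Defs
  imports Complex_Main "HOL-Library.Poly_Mapping"
begin

text \<open>The letter \<open>(i, True)\<close> stands for \<open>\<sigma>\<^sub>i\<close> and \<open>(i, False)\<close> for its inverse.\<close>

type_synonym letter = "nat \<times> bool"

definition braid_words :: "nat \<Rightarrow> letter list set" where
  "braid_words n = lists ({1..<n} \<times> UNIV)"

text \<open>\<open>braid_eq n\<close> is equality in \<open>B\<^sub>n\<close>: the congruence on words in \<open>\<sigma>\<^sub>1, \<dots>, \<sigma>\<^sub>n\<^sub>-\<^sub>1\<close> and their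
  inverses generated by free cancellation and the braid relations.\<close>

inductive braid_eq :: "nat \<Rightarrow> letter list \<Rightarrow> letter list \<Rightarrow> bool" for n where
  refl: "w \<in> braid_words n \<Longrightarrow> braid_eq n w w"
| sym: "braid_eq n v w \<Longrightarrow> braid_eq n w v"
| trans: "braid_eq n u v \<Longrightarrow> braid_eq n v w \<Longrightarrow> braid_eq n u w"
| cancel: "u \<in> braid_words n \<Longrightarrow> v \<in> braid_words n \<Longrightarrow> i \<in> {1..<n} \<Longrightarrow>
    braid_eq n (u @ [(i, e), (i, \<not> e)] @ v) (u @ v)"
| braid: "u \<in> braid_words n \<Longrightarrow> v \<in> braid_words n \<Longrightarrow> i \<in> {1..<n} \<Longrightarrow> j \<in> {1..<n} \<Longrightarrow>
    \<bar>int i - int j\<bar> = 1 \<Longrightarrow>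
    braid_eq n (u @ [(i, True), (j, True), (i, True)] @ v)
               (u @ [(j, True), (i, True), (j, True)] @ v)"
| commute: "u \<in> braid_words n \<Longrightarrow> v \<in> braid_words n \<Longrightarrow> i \<in> {1..<n} \<Longrightarrow> j \<in> {1..<n} \<Longrightarrow>
    \<bar>int i - int j\<bar> > 1 \<Longrightarrow>
    braid_eq n (u @ [(i, True), (j, True)] @ v) (u @ [(j, True), (i, True)] @ v)"

lemma braid_words_mono: "n \<le> m \<Longrightarrow> w \<in> braid_words n \<Longrightarrow> w \<in> braid_words m"
  by (force simp: braid_words_def)

lemma braid_words_append [simp]:
  "u @ v \<in> braid_words n \<longleftrightarrow> u \<in> braid_words n \<and> v \<in> braid_words n"
  by (simp add: braid_words_def)

lemma braid_words_Nil [simp]: "[] \<in> braid_words n"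
  by (simp add: braid_words_def)

lemma braid_words_Cons [simp]:
  "(i, e) # v \<in> braid_words n \<longleftrightarrow> i \<in> {1..<n} \<and> v \<in> braid_words n"
  by (simp add: braid_words_def)

lemma braid_eq_words: "braid_eq n v w \<Longrightarrow> v \<in> braid_words n \<and> w \<in> braid_words n"
  by (induction rule: braid_eq.induct) auto

lemma braid_eq_mono:
  assumes "n \<le> m"
  shows "braid_eq n v w \<Longrightarrow> braid_eq m v w"
proof (induction rule: braid_eq.induct)
  case trans
  then show ?case by (blast intro: braid_eq.trans)
qed (use assms in \<open>auto intro: braid_eq.refl braid_eq.sym braid_eq.cancel[simplified]
        braid_eq.braid[simplified] braid_eq.commute[simplified] dest: braid_words_mono\<close>)

lemma braid_eq_context:
  assumes "braid_eq n v w" and ab: "a \<in> braid_words n" "b \<in> braid_words n"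
  shows "braid_eq n (a @ v @ b) (a @ w @ b)"
  using assms(1)
proof (induction rule: braid_eq.induct)
  case (refl w)
  then show ?case using ab by (simp add: braid_eq.refl)
next
  case (sym v w)
  then show ?case by (blast intro: braid_eq.sym)
next
  case (trans u v w)
  then show ?case by (blast intro: braid_eq.trans)
next
  case (cancel u v i e)
  then show ?case using ab braid_eq.cancel[of "a @ u" n "v @ b" i e] by simp
next
  case (braid u v i j)
  then show ?case using ab braid_eq.braid[of "a @ u" n "v @ b" i j] by simp
next
  case (commute u v i j)
  then show ?case using ab braid_eq.commute[of "a @ u" n "v @ b" i j] by simp
qed

lemma braid_eq_append:
  assumes "braid_eq n v w" "braid_eq n v' w'"
  shows "braid_eq n (v @ v') (w @ w')"
  using braid_eq_context[OF assms(1), of "[]" v'] braid_eq_context[OF assms(2), of w "[]"]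
    braid_eq_words[OF assms(1)] braid_eq_words[OF assms(2)]
  by (auto intro: braid_eq.trans)

definition inverse_word :: "letter list \<Rightarrow> letter list" where
  "inverse_word w = rev (map (map_prod id Not) w)"

lemma inverse_word_in [simp]: "inverse_word w \<in> braid_words n \<longleftrightarrow> w \<in> braid_words n"
  by (auto simp: inverse_word_def braid_words_def in_lists_conv_set)

lemma inverse_word_inverse_word [simp]: "inverse_word (inverse_word w) = w"
  by (simp add: inverse_word_def rev_map comp_def map_prod_def case_prod_unfold)

lemma braid_eq_left_inverse: "w \<in> braid_words n \<Longrightarrow> braid_eq n (inverse_word w @ w) []"
proof (induction w)
  case Nil
  then show ?case by (simp add: inverse_word_def braid_eq.refl)
next
  case (Cons x w)
  obtain i e where x: "x = (i, e)" by fastforce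
  have "braid_eq n (inverse_word w @ [(i, \<not> e), (i, \<not> \<not> e)] @ w) (inverse_word w @ w)"
    using Cons.prems x by (intro braid_eq.cancel) auto
  moreover have "braid_eq n (inverse_word w @ w) []"
    using Cons x by simp
  ultimately show ?case
    by (auto simp: x inverse_word_def intro: braid_eq.trans)
qed

lemma braid_eq_inverse_word:
  assumes "braid_eq n v w"
  shows "braid_eq n (inverse_word v) (inverse_word w)"
proof -
  have v: "v \<in> braid_words n" and w: "w \<in> braid_words n"
    using braid_eq_words[OF assms] by auto
  have 1: "braid_eq n (inverse_word v @ w @ inverse_word w) (inverse_word v)"
    using braid_eq_append[OF braid_eq.refl[of "inverse_word v" n]
        braid_eq_left_inverse[of "inverse_word w" n]] v w by simp
  have "braid_eq n (inverse_word v @ w) []"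
    using braid_eq_append[OF braid_eq.refl[of "inverse_word v" n] braid_eq.sym[OF assms]]
      braid_eq_left_inverse[OF v] v by (auto intro: braid_eq.trans)
  from braid_eq_append[OF this braid_eq.refl[of "inverse_word w" n]] w
  have "braid_eq n (inverse_word v @ w @ inverse_word w) (inverse_word w)"
    by simp
  with 1 show ?thesis
    by (blast intro: braid_eq.sym braid_eq.trans)
qed

definition braid_eq_lim :: "letter list \<Rightarrow> letter list \<Rightarrow> bool" where
  "braid_eq_lim v w \<longleftrightarrow> (\<exists>n. braid_eq n v w)"

lemma braid_eq_lim_sym: "braid_eq_lim v w \<Longrightarrow> braid_eq_lim w v"
  by (auto simp: braid_eq_lim_def intro: braid_eq.sym)

lemma braid_eq_lim_common:
  assumes "braid_eq_lim v w" "braid_eq_lim v' w'"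
  obtains n where "braid_eq n v w" "braid_eq n v' w'"
  using assms braid_eq_mono[OF max.cobounded1] braid_eq_mono[OF max.cobounded2]
  unfolding braid_eq_lim_def by blast

lemma braid_eq_lim_append:
  "braid_eq_lim v w \<Longrightarrow> braid_eq_lim v' w' \<Longrightarrow> braid_eq_lim (v @ v') (w @ w')"
  by (erule (1) braid_eq_lim_common) (auto simp: braid_eq_lim_def intro: braid_eq_append)

lemma braid_eq_lim_trans: "braid_eq_lim u v \<Longrightarrow> braid_eq_lim v w \<Longrightarrow> braid_eq_lim u w"
  by (erule (1) braid_eq_lim_common) (auto simp: braid_eq_lim_def intro: braid_eq.trans)

text \<open>The direct limit \<open>B\<^sub>\<infinity>\<close> of the groups \<open>B\<^sub>n\<close>: a word represents an element of \<open>B\<^sub>n\<close> for all large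
  \<open>n\<close>, and two words agree in the limit iff they agree in some \<open>B\<^sub>n\<close>. The quotient is partial since
  words containing a letter of index \<open>0\<close> represent nothing.\<close>

quotient_type braid = "letter list" / partial: braid_eq_lim
proof (rule part_equivpI)
  show "\<exists>x. braid_eq_lim x x"
    by (auto simp: braid_eq_lim_def intro: braid_eq.refl[OF braid_words_Nil])
  show "symp braid_eq_lim"
    by (blast intro: sympI braid_eq_lim_sym)
  show "transp braid_eq_lim"
    by (blast intro: transpI braid_eq_lim_trans)
qed

text \<open>The group operation on \<open>B\<^sub>\<infinity>\<close> is written additively (\<open>group_add\<close> is not assumed commutative),
  so that the convolution product of \<open>poly_mapping\<close> makes \<open>braid \<Rightarrow>\<^sub>0 'k\<close> the group algebra
  \<open>\<kk>B\<^sub>\<infinity>\<close>.\<close>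

instantiation braid :: group_add
begin

lift_definition zero_braid :: braid is "[]"
  by (auto simp: braid_eq_lim_def intro: braid_eq.refl[OF braid_words_Nil])

lift_definition plus_braid :: "braid \<Rightarrow> braid \<Rightarrow> braid" is append
  by (rule braid_eq_lim_append)

lift_definition uminus_braid :: "braid \<Rightarrow> braid" is inverse_word
  by (auto simp: braid_eq_lim_def intro: braid_eq_inverse_word)

definition minus_braid :: "braid \<Rightarrow> braid \<Rightarrow> braid" where
  "minus_braid g h = g + - h"

instance
proof
  fix a b c :: braid
  show "a + b + c = a + (b + c)"
    by transfer (simp add: braid_eq_lim_append)
  show "0 + a = a" by transfer simp
  show "a + 0 = a" by transfer simp
  show "- a + a = 0"
    by transfer (auto simp: braid_eq_lim_def intro: braid_eq_left_inverse dest: braid_eq_words)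
  show "a + - b = a - b" by (simp add: minus_braid_def)
qed

end

text \<open>\<open>\<sigma>\<^sub>i\<close> for \<open>i \<ge> 1\<close>; the value at \<open>0\<close> is a dummy.\<close>

lift_definition sigma :: "nat \<Rightarrow> braid" is "\<lambda>i. if i = 0 then [] else [(i, True)]"
  subgoal for i
    unfolding braid_eq_lim_def
    by (rule exI[of _ "Suc i"], rule braid_eq.refl) auto
  done

definition shift_word :: "nat \<Rightarrow> letter list \<Rightarrow> letter list" where
  "shift_word l w = map (\<lambda>(i, e). (i + l, e)) w"

lemma shift_word_append: "shift_word l (v @ w) = shift_word l v @ shift_word l w"
  by (simp add: shift_word_def)

lemma shift_word_in: "w \<in> braid_words n \<Longrightarrow> shift_word l w \<in> braid_words (n + l)"
  by (auto simp: shift_word_def braid_words_def in_lists_conv_set)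

lemma braid_eq_shift_word: "braid_eq n v w \<Longrightarrow> braid_eq (n + l) (shift_word l v) (shift_word l w)"
proof (induction rule: braid_eq.induct)
  case (refl w)
  then show ?case by (intro braid_eq.refl shift_word_in)
next
  case (sym v w)
  then show ?case by (blast intro: braid_eq.sym)
next
  case (trans u v w)
  then show ?case by (blast intro: braid_eq.trans)
next
  case (cancel u v i e)
  then show ?case
    using braid_eq.cancel[OF shift_word_in shift_word_in, of u n v "i + l" l e]
    by (simp add: shift_word_def)
next
  case (braid u v i j)
  then show ?case
    using braid_eq.braid[OF shift_word_in shift_word_in, of u n v "i + l" l "j + l"]
    by (simp add: shift_word_def)
next
  case (commute u v i j)
  then show ?case
    using braid_eq.commute[OF shift_word_in shift_word_in, of u n v "i + l" l "j + l"]
    by (simp add: shift_word_def)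
qed

lemma braid_eq_lim_shift_word:
  "braid_eq_lim v w \<Longrightarrow> braid_eq_lim (shift_word l v) (shift_word l w)"
  by (auto simp: braid_eq_lim_def intro: braid_eq_shift_word)

lift_definition braid_shift :: "nat \<Rightarrow> braid \<Rightarrow> braid" is shift_word
  by (rule braid_eq_lim_shift_word)

lemma braid_shift_sigma: "i \<ge> 1 \<Longrightarrow> braid_shift l (sigma i) = sigma (i + l)"
  by transfer
    (auto simp: shift_word_def braid_eq_lim_def intro!: exI[of _ "Suc (_ + _)"] braid_eq.refl)

lemma braid_shift_zero: "braid_shift l 0 = 0"
  by transfer (auto simp: shift_word_def braid_eq_lim_def intro: braid_eq.refl[OF braid_words_Nil])

lemma braid_shift_add: "braid_shift l (g + h) = braid_shift l g + braid_shift l h"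
  by transfer (simp add: shift_word_append braid_eq_lim_append braid_eq_lim_shift_word)


definition scalar :: "'k \<Rightarrow> (braid \<Rightarrow>\<^sub>0 'k::field)" where
  "scalar x = Poly_Mapping.single 0 x"

definition of_braid :: "braid \<Rightarrow> (braid \<Rightarrow>\<^sub>0 'k::field)" where
  "of_braid g = Poly_Mapping.single g 1"

definition shift :: "(braid \<Rightarrow>\<^sub>0 'k::field) \<Rightarrow> nat \<Rightarrow> (braid \<Rightarrow>\<^sub>0 'k)" (infixl \<open>\<up>\<close> 75) where
  "x \<up> l = (\<Sum>g\<in>Poly_Mapping.keys x.
      Poly_Mapping.single (braid_shift l g) (Poly_Mapping.lookup x g))"


text \<open>\<open>(\<sigma>\<^sub>k \<cdots> \<sigma>\<^sub>k\<^sub>+\<^sub>l\<^sub>-\<^sub>1)(\<sigma>\<^sub>k\<^sub>-\<^sub>1 \<cdots> \<sigma>\<^sub>k\<^sub>+\<^sub>l\<^sub>-\<^sub>2) \<cdots> (\<sigma>\<^sub>1 \<cdots> \<sigma>\<^sub>l)\<close>\<close>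

definition beta :: "nat \<Rightarrow> nat \<Rightarrow> braid" where
  "beta k l = (\<Sum>r\<leftarrow>rev [1..<Suc k]. \<Sum>i\<leftarrow>[r..<r + l]. sigma i)"

function shuffle_elem :: "int \<Rightarrow> int \<Rightarrow> (braid \<Rightarrow>\<^sub>0 'k::field)" where
  "shuffle_elem m n =
    (if m < 0 \<or> n < 0 then 0
     else if m = 0 \<and> n = 0 then 1
     else shuffle_elem (m - 1) n
       + shuffle_elem m (n - 1) * (of_braid (beta (nat m) 1) \<up> nat (n - 1)))"
  by auto
termination
  by (relation "Wellfounded.measure (\<lambda>(m, n). nat (m + n + 1))") auto

declare shuffle_elem.simps [simp del]

definition pochhammer_elem :: "nat \<Rightarrow> nat \<Rightarrow> 'k \<Rightarrow> 'k \<Rightarrow> (braid \<Rightarrow>\<^sub>0 'k::field)" where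
  "pochhammer_elem k n x y =
    (\<Prod>i\<leftarrow>[0..<n]. scalar x - of_braid (beta (k + i) 1) * scalar y)"


definition p_elem :: "'k \<Rightarrow> nat \<Rightarrow> nat \<Rightarrow> (braid \<Rightarrow>\<^sub>0 'k::field)" where
  "p_elem q a b = pochhammer_elem a b 1 (q powi (- 2))"

text \<open>Only meaningful for \<open>c \<le> b\<close>.\<close>

definition A_elem :: "'k \<Rightarrow> nat \<Rightarrow> nat \<Rightarrow> nat \<Rightarrow> (braid \<Rightarrow>\<^sub>0 'k::field)" where
  "A_elem q a b c =
    scalar (q powi (1 - int a - int c))
      * (shuffle_elem (int b - int c) (int c) \<up> a)
      * of_braid (beta a c)
      * (p_elem q a (b - c) \<up> c)"

end

theory Submission
  imports Defs
begin

text \<open>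
  The elements \<open>A_elem\<close> are the components of a braiding \<open>w \<otimes> x \<mapsto> x\<^sub>1 \<otimes> (w \<triangleleft> x\<^sub>2)\<close> on the tensor
  algebra \<open>T(V)\<close> of a braided vector space, and the Yang--Baxter equation holds because \<open>T(V)\<close> is a
  Yetter--Drinfeld module over itself. Products are read from left to right, as operations applied to
  a word one after the other. Write \<open>S\<close>, \<open>B\<close>, \<open>p\<close> for the shuffle elements, the \<open>\<beta>\<close>'s and the Pochhammer
  symbols, and \<open>t = q\<^sup>-\<^sup>2\<close>.

  \<^item> \<open>S m n\<close> is the component \<open>T\<^sup>m\<^sup>+\<^sup>n \<rightarrow> T\<^sup>n \<otimes> T\<^sup>m\<close> of the braided unshuffle coproduct \<open>x \<mapsto> x\<^sub>1 \<otimes> x\<^sub>2\<close>. It is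
    coassociative (\<open>shuffle_coassoc\<close>).
  \<^item> \<open>B k l\<close> moves a block of \<open>k\<close> strands past a block of \<open>l\<close> strands. It is natural in both blocks
    (\<open>B_natural_left\<close>, \<open>B_natural_right\<close>) and satisfies the hexagon identities (\<open>B_add_left\<close>,
    \<open>B_add_right\<close>).
  \<^item> \<open>p t a n\<close> is the right action \<open>w \<triangleleft> x\<close> of a word \<open>x\<close> of length \<open>n\<close> on a word \<open>w\<close> of length \<open>a\<close>: a
    letter \<open>v\<close> acts by the \<open>t\<close>-twisted braided commutator \<open>w \<mapsto> w v - t v w\<close>, and the letters of \<open>x\<close> act
    in turn. Being an action amounts to \<open>pochhammer_add\<close>.

  By coassociativity and naturality the same outer factors can be split off from both sides
  (\<open>wrap_yd_left\<close>, \<open>wrap_yd_right\<close>). What remains is the compatibility of action and coaction,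
  \<open>\<Sum> t\<^sup>k (x \<triangleleft> y\<^sub>2)\<^sub>1 \<otimes> y\<^sub>1 (x \<triangleleft> y\<^sub>2)\<^sub>2 = \<Sum> (x\<^sub>1 \<triangleleft> y\<^sub>1) \<otimes> x\<^sub>2 y\<^sub>2\<close> with \<open>k\<close> the length of \<open>y\<^sub>1\<close>, which is
  \<open>yetter_drinfeld\<close>. The power of \<open>t\<close> is exactly what the scalars \<open>q\<^sup>1\<^sup>-\<^sup>a\<^sup>-\<^sup>c\<close> leave over. The compatibility
  passes from two words \<open>y\<close>, \<open>z\<close> to their concatenation, so it only has to be verified for a single letter
  (\<open>yetter_drinfeld_letter\<close>), where it follows from the recursions of the coproduct by the last letter
  (its definition) and by the first letter (\<open>shuffle_first_rec\<close>).
\<close>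

section \<open>The group algebra and its shifts\<close>

text \<open>Together with \<open>mult.assoc\<close> this turns an equation between two factors into a rewrite rule that
  applies anywhere inside a right-nested product.\<close>

lemma mult_left_assoc: "x * y = w \<Longrightarrow> x * (y * z) = w * (z :: 'a :: semigroup_mult)"
  by (simp flip: mult.assoc)

lemma of_braid_0: "of_braid 0 = 1"
  by (simp add: of_braid_def)

lemma of_braid_add: "of_braid (g + h) = of_braid g * of_braid h"
  by (simp add: of_braid_def mult_single)

lemma scalar_1 [simp]: "scalar 1 = 1"
  by (simp add: scalar_def)

lemma scalar_mult: "scalar (x * y) = scalar x * scalar y"
  by (simp add: scalar_def mult_single)

lemma scalar_minus: "scalar (- x) = - scalar x"
  by (simp add: scalar_def single_uminus)

lemma group_algebra_sum_singles:
  "(\<Sum>g\<in>Poly_Mapping.keys x. Poly_Mapping.single g (Poly_Mapping.lookup x g)) = x"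
  by (rule poly_mapping_eqI)
    (simp add: lookup_sum lookup_single when_def in_keys_iff)

lemma group_algebra_induct [case_names single add]:
  assumes "\<And>g x. P (Poly_Mapping.single g x)" "\<And>x y. P x \<Longrightarrow> P y \<Longrightarrow> P (x + y)"
  shows "P (x :: braid \<Rightarrow>\<^sub>0 'k::field)"
proof -
  have "P (\<Sum>g\<in>K. Poly_Mapping.single g (Poly_Mapping.lookup x g))" if "finite K" for K
    using that by (induction K) (use assms in \<open>auto simp: assms(1)[of _ 0, simplified]\<close>)
  from this[of "Poly_Mapping.keys x"] show ?thesis
    by (simp add: group_algebra_sum_singles)
qed

lemma scalar_central: "x * scalar c = scalar c * (x :: braid \<Rightarrow>\<^sub>0 'k::field)"
  by (induction x rule: group_algebra_induct)
    (simp_all add: scalar_def mult_single distrib_left distrib_right mult.commute)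

lemma shift_single: "Poly_Mapping.single g x \<up> l = Poly_Mapping.single (braid_shift l g) x"
  by (cases "x = 0") (simp_all add: shift_def)

lemma shift_eq_sum:
  assumes "finite K" "Poly_Mapping.keys x \<subseteq> K"
  shows "x \<up> l = (\<Sum>g\<in>K. Poly_Mapping.single (braid_shift l g) (Poly_Mapping.lookup x g))"
  unfolding shift_def using assms
  by (intro sum.mono_neutral_left) (auto simp: in_keys_iff)

lemma shift_add: "(x + y) \<up> l = x \<up> l + y \<up> l"
proof -
  define K where "K = Poly_Mapping.keys x \<union> Poly_Mapping.keys y"
  have K: "finite K" "Poly_Mapping.keys x \<subseteq> K" "Poly_Mapping.keys y \<subseteq> K" "Poly_Mapping.keys (x + y) \<subseteq> K"
    using keys_add[of x y] by (auto simp: K_def)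
  show ?thesis
    by (simp add: shift_eq_sum[OF K(1,2)] shift_eq_sum[OF K(1,3)] shift_eq_sum[OF K(1,4)]
        lookup_add single_add sum.distrib)
qed

lemma shift_zero [simp]: "0 \<up> l = 0"
  by (simp add: shift_def)

lemma shift_one [simp]: "1 \<up> l = 1"
  using shift_single[of 0 1 l] by (simp add: braid_shift_zero)

lemma shift_mult: "(x * y) \<up> l = (x \<up> l) * (y \<up> l)"
proof (induction x rule: group_algebra_induct)
  case (single g c)
  show ?case
    by (induction y rule: group_algebra_induct)
      (simp_all add: mult_single shift_single braid_shift_add distrib_left shift_add)
qed (simp add: distrib_right shift_add)

lemma shift_scalar [simp]: "scalar c \<up> l = scalar c"
  by (simp add: scalar_def shift_single braid_shift_zero)

lemma shift_sum: "(\<Sum>i\<in>I. f i) \<up> l = (\<Sum>i\<in>I. f i \<up> l)"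
  by (induction I rule: infinite_finite_induct) (simp_all add: shift_add)

lemma braid_shift_shift: "braid_shift l (braid_shift m g) = braid_shift (m + l) g"
proof -
  have "shift_word l (shift_word m w) = shift_word (m + l) w" for w
    by (simp add: shift_word_def case_prod_unfold comp_def add.assoc)
  then show ?thesis
    by transfer (simp only: braid_eq_lim_shift_word)
qed

lemma braid_shift_by_0: "braid_shift 0 g = g"
  by transfer (simp add: shift_word_def)

lemma shift_shift [simp]: "x \<up> m \<up> l = x \<up> (m + l)"
  by (induction x rule: group_algebra_induct)
    (simp_all add: shift_single braid_shift_shift shift_add)

lemma shift_by_0 [simp]: "x \<up> 0 = x"
  by (induction x rule: group_algebra_induct) (simp_all add: shift_single braid_shift_by_0 shift_add)

section \<open>Generators and disjoint strands\<close>

text \<open>Fixing \<open>K\<close> serves to fix the coefficient field, so that all abbreviations below denote elements of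
  one and the same group algebra.\<close>

context
  fixes K :: "'k::field itself"
begin

abbreviation gen :: "nat \<Rightarrow> (braid \<Rightarrow>\<^sub>0 'k)" where
  "gen i \<equiv> of_braid (sigma i)"

lemma shift_gen: "i \<ge> 1 \<Longrightarrow> gen i \<up> l = gen (i + l)"
  by (simp add: of_braid_def shift_single braid_shift_sigma)

lemma gen_commute:
  assumes "i \<ge> 1" "i + 1 < j"
  shows "gen i * gen j = gen j * gen i"
proof -
  have "sigma i + sigma j = sigma j + sigma i"
  proof (transfer fixing: i j)
    show "braid_eq_lim ((if i = 0 then [] else [(i, True)]) @ (if j = 0 then [] else [(j, True)]))
        ((if j = 0 then [] else [(j, True)]) @ (if i = 0 then [] else [(i, True)]))"
      using assms braid_eq.commute[of "[]" "Suc j" "[]" i j]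
      by (auto simp: braid_eq_lim_def)
  qed
  then show ?thesis
    by (simp flip: of_braid_add)
qed

lemma gen_braid:
  assumes "i \<ge> 1"
  shows "gen i * gen (Suc i) * gen i = gen (Suc i) * gen i * gen (Suc i)"
proof -
  have "sigma i + sigma (Suc i) + sigma i = sigma (Suc i) + sigma i + sigma (Suc i)"
    using assms
  proof (transfer fixing: i)
    show "braid_eq_lim (((if i = 0 then [] else [(i, True)]) @ (if Suc i = 0 then [] else [(Suc i, True)])) @
            (if i = 0 then [] else [(i, True)]))
          (((if Suc i = 0 then [] else [(Suc i, True)]) @ (if i = 0 then [] else [(i, True)])) @
            (if Suc i = 0 then [] else [(Suc i, True)]))"
      using assms braid_eq.braid[of "[]" "Suc (Suc i)" "[]" i "Suc i"]
      by (auto simp: braid_eq_lim_def)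
  qed
  then show ?thesis
    by (simp flip: of_braid_add)
qed

text \<open>Braids on the strands \<open>l + 1, \<dots>, n\<close>: the subalgebra generated by \<open>\<sigma>\<^sub>l\<^sub>+\<^sub>1, \<dots>, \<sigma>\<^sub>n\<^sub>-\<^sub>1\<close>. It is
  the span of the positive braids on these strands.\<close>

inductive strands :: "nat \<Rightarrow> nat \<Rightarrow> (braid \<Rightarrow>\<^sub>0 'k) \<Rightarrow> bool" for l n where
  scalar: "strands l n (scalar c)"
| gen: "l < i \<Longrightarrow> i < n \<Longrightarrow> strands l n (gen i)"
| add: "strands l n x \<Longrightarrow> strands l n y \<Longrightarrow> strands l n (x + y)"
| mult: "strands l n x \<Longrightarrow> strands l n y \<Longrightarrow> strands l n (x * y)"

lemma strands_1 [simp]: "strands l n 1"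
  using strands.scalar[of l n 1] by simp

lemma strands_0 [simp]: "strands l n 0"
  using strands.scalar[of l n 0] by (simp add: scalar_def)

lemma strands_diff: "strands l n x \<Longrightarrow> strands l n y \<Longrightarrow> strands l n (x - y)"
  using strands.add[of l n x "scalar (- 1) * y"] strands.mult[OF strands.scalar[of l n "- 1"], of y]
  by (simp add: scalar_minus)

lemma strands_mono: "strands l n x \<Longrightarrow> l' \<le> l \<Longrightarrow> n \<le> n' \<Longrightarrow> strands l' n' x"
  by (induction rule: strands.induct) (auto intro: strands.intros)

lemma strands_shift: "strands l n x \<Longrightarrow> l' \<le> l + d \<Longrightarrow> n + d \<le> n' \<Longrightarrow> strands l' n' (x \<up> d)"
  by (induction rule: strands.induct)
    (auto intro: strands.intros simp: shift_gen shift_add shift_mult)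

lemma strands_commute:
  assumes "strands l n x" "strands l' n' y" "n \<le> l'"
  shows "x * y = y * x"
  using assms(1)
proof (induction rule: strands.induct)
  case (gen i)
  show ?case
    using assms(2)
  proof (induction rule: strands.induct)
    case (gen j)
    then show ?case
      using gen_commute[of i j] assms(3) \<open>l < i\<close> \<open>i < n\<close> by simp
  next
    case (mult x y)
    then show ?case by (metis mult.assoc)
  qed (simp_all add: scalar_central distrib_left distrib_right)
next
  case (mult x x')
  then show ?case by (metis mult.assoc)
qed (simp_all add: scalar_central distrib_left distrib_right)

lemma shifts_commute:
  assumes "strands 0 m x" "strands 0 n y" "a + m \<le> d"
  shows "(x \<up> a) * (y \<up> d) = (y \<up> d) * (x \<up> a)"
  by (rule strands_commute[OF strands_shift[OF assms(1) order.refl order.refl] strands_shift[OF assms(2) order.refl order.refl]])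
    (use assms(3) in auto)

section \<open>Block crossings\<close>

abbreviation B :: "nat \<Rightarrow> nat \<Rightarrow> (braid \<Rightarrow>\<^sub>0 'k)" where
  "B k l \<equiv> of_braid (beta k l)"

text \<open>One factor \<open>\<sigma>\<^sub>r \<cdots> \<sigma>\<^sub>r\<^sub>+\<^sub>l\<^sub>-\<^sub>1\<close> of \<open>\<beta>\<^sub>k\<^sub>,\<^sub>l\<close>: the strand at position \<open>r\<close> crosses the next \<open>l\<close> strands.\<close>

definition row :: "nat \<Rightarrow> nat \<Rightarrow> (braid \<Rightarrow>\<^sub>0 'k)" where
  "row r l = of_braid (\<Sum>i\<leftarrow>[r..<r + l]. sigma i)"

lemma row_0 [simp]: "row r 0 = 1"
  by (simp add: row_def of_braid_0)

lemma row_Suc: "row r (Suc l) = row r l * gen (r + l)"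
  by (simp add: row_def of_braid_add)

lemma row_add: "row r (l + m) = row r l * row (r + l) m"
  by (induction m) (simp_all add: row_Suc mult.assoc add.assoc)

lemma row_shift: "r \<ge> 1 \<Longrightarrow> row r l \<up> d = row (r + d) l"
  by (induction l) (simp_all add: row_Suc shift_mult shift_gen add_ac)

lemma strands_row: "m < r \<Longrightarrow> r + l \<le> n \<Longrightarrow> strands m n (row r l)"
  by (induction l) (auto simp: row_Suc intro!: strands.intros)

lemma B_0_left [simp]: "B 0 l = 1"
  by (simp add: beta_def of_braid_0)

lemma B_Suc: "B (Suc k) l = row (Suc k) l * B k l"
  by (simp add: beta_def row_def of_braid_add)

lemma B_0_right [simp]: "B k 0 = 1"
  by (induction k) (simp_all add: B_Suc)

lemma strands_B: "k + l \<le> n \<Longrightarrow> strands 0 n (B k l)"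
  by (induction k) (auto simp: B_Suc intro!: strands.mult strands_row)

lemma B_1_Suc: "B (Suc k) (Suc 0) = gen (Suc k) * B k (Suc 0)"
  by (simp add: B_Suc row_Suc)

lemma B_add_left: "B (k + k') l = (B k' l \<up> k) * B k l"
  by (induction k') (simp_all add: B_Suc shift_mult row_shift add_ac mult.assoc)

text \<open>The rows of length \<open>l + l'\<close> are cut after \<open>l\<close> letters. The tail of each row has only letters of index
  at least two above those of the heads of the later rows, and so moves past them.\<close>

lemma B_add_right: "B k (l + l') = B k l * (B k l' \<up> l)"
proof (induction k)
  case (Suc k)
  have *: "B k l * row (Suc (k + l)) l' = row (Suc (k + l)) l' * B k l"
    by (rule strands_commute[OF strands_B[OF order.refl] strands_row[OF lessI order.refl] order.refl])
  show ?case
    by (simp add: B_Suc Suc row_add shift_mult row_shift mult.assoc)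
      (simp add: mult.assoc[symmetric] *)
qed simp

text \<open>The two naturality statements for a single strand. The generator moves past all letters but
  two, and with these two it forms a braid relation that changes its index by one.\<close>

lemma gen_B_1:
  assumes "1 \<le> i" "i < k"
  shows "gen i * B k (Suc 0) = (B k (Suc 0) * gen (Suc i) :: braid \<Rightarrow>\<^sub>0 'k)"
  using assms
proof (induction k)
  case (Suc k)
  show ?case
  proof (cases "i = k")
    case True
    then obtain k' where k: "k = Suc k'" using Suc.prems by (cases k) auto
    have *: "B k' (Suc 0) * gen (Suc k) = gen (Suc k) * B k' (Suc 0)"
      by (rule strands_commute[OF strands_B[OF order.refl] strands.gen[of k _ "Suc (Suc k)"]]) (auto simp: k)
    have "gen k * (gen (Suc k) * gen k * B k' (Suc 0)) = gen (Suc k) * gen k * gen (Suc k) * B k' (Suc 0)"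
      using k by (simp add: gen_braid mult.assoc[symmetric])
    also have "\<dots> = gen (Suc k) * gen k * B k' (Suc 0) * gen (Suc k)"
      by (simp add: * mult.assoc)
    finally show ?thesis
      using True by (simp add: k B_1_Suc mult.assoc)
  next
    case False
    then have *: "(gen i :: braid \<Rightarrow>\<^sub>0 'k) * gen (Suc k) = gen (Suc k) * gen i" "(gen i :: braid \<Rightarrow>\<^sub>0 'k) * B k (Suc 0) = B k (Suc 0) * gen (Suc i)"
      using Suc by (auto intro: gen_commute)
    then show ?thesis
      by (simp add: B_1_Suc *(2) mult_left_assoc[OF *(1)] mult.assoc)
  qed
qed simp

lemma row_gen:
  assumes "1 \<le> j" "j < l"
  shows "gen (Suc j) * row (Suc 0) l = (row (Suc 0) l * gen j :: braid \<Rightarrow>\<^sub>0 'k)"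
  using assms
proof (induction l)
  case (Suc l)
  show ?case
  proof (cases "j = l")
    case True
    then obtain l' where l: "l = Suc l'" using Suc.prems by (cases l) auto
    have *: "row (Suc 0) l' * gen (Suc l) = gen (Suc l) * row (Suc 0) l'"
      by (rule strands_commute[OF strands_row[of 0 "Suc 0" l' "Suc l'"] strands.gen[of l _ "Suc (Suc l)"]]) (auto simp: l)
    have "gen (Suc l) * (row (Suc 0) l' * gen l * gen (Suc l)) = row (Suc 0) l' * (gen (Suc l) * gen l * gen (Suc l))"
      by (simp add: * mult.assoc[symmetric])
    also have "\<dots> = row (Suc 0) l' * gen l * gen (Suc l) * gen l"
      using l by (simp add: gen_braid[symmetric, simplified mult.assoc] mult.assoc)
    finally show ?thesis
      using True by (simp add: l row_Suc mult.assoc)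
  next
    case False
    then have *: "(gen j :: braid \<Rightarrow>\<^sub>0 'k) * gen (Suc l) = gen (Suc l) * gen j"
        "(gen (Suc j) :: braid \<Rightarrow>\<^sub>0 'k) * row (Suc 0) l = row (Suc 0) l * gen j"
      using Suc by (auto intro: gen_commute)
    then show ?thesis
      by (simp add: row_Suc *(1) mult_left_assoc[OF *(2)] mult.assoc)
  qed
qed simp

text \<open>Naturality of the crossing \<open>B k l\<close> in the block of \<open>k\<close> strands, which it moves \<open>l\<close> places to the
  right, and in the block of \<open>l\<close> strands, which it moves \<open>k\<close> places to the left.\<close>

lemma B_natural_left:
  assumes "strands 0 k x"
  shows "x * B k l = B k l * (x \<up> l)"
proof (induction l)
  case (Suc l)
  have 1: "y * B k (Suc 0) = B k (Suc 0) * (y \<up> Suc 0)" if "strands 0 k y" for y :: "braid \<Rightarrow>\<^sub>0 'k"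
    using that
  proof (induction rule: strands.induct)
    case (mult x y)
    then show ?case by (simp add: shift_mult) (metis mult.assoc)
  qed (simp_all add: scalar_central gen_B_1 shift_gen shift_add distrib_left distrib_right)
  have "x * B k (Suc l) = B k l * ((x * B k (Suc 0)) \<up> l)"
    by (simp add: B_add_right[of k l "Suc 0", simplified] Suc shift_mult mult.assoc[symmetric])
  also have "\<dots> = B k (Suc l) * (x \<up> Suc l)"
    by (simp add: B_add_right[of k l "Suc 0", simplified] 1[OF assms] shift_mult mult.assoc[symmetric])
  finally show ?case .
qed simp

lemma B_natural_right:
  assumes "strands 0 l y"
  shows "(y \<up> k) * B k l = B k l * y"
proof (induction k)
  case (Suc k)
  have 1: "(y \<up> Suc 0) * row (Suc 0) l = row (Suc 0) l * y" if "strands 0 l y" for y :: "braid \<Rightarrow>\<^sub>0 'k"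
    using that
  proof (induction rule: strands.induct)
    case (mult x y)
    then show ?case by (simp add: shift_mult) (metis mult.assoc)
  qed (simp_all add: scalar_central row_gen shift_gen shift_add distrib_left distrib_right)
  have row: "row (Suc k) l = row (Suc 0) l \<up> k"
    by (simp add: row_shift)
  have "(y \<up> Suc k) * B (Suc k) l = (((y \<up> Suc 0) * row (Suc 0) l) \<up> k) * B k l"
    unfolding B_Suc row by (simp add: shift_mult mult.assoc[symmetric])
  also have "\<dots> = (row (Suc 0) l \<up> k) * ((y \<up> k) * B k l)"
    unfolding 1[OF assms] by (simp add: shift_mult mult.assoc)
  finally show ?case
    unfolding B_Suc row Suc by (simp add: mult.assoc)
qed simp

section \<open>Shuffle elements as a coproduct\<close>

text \<open>Integer arguments are kept, because the vanishing of \<open>S m n\<close> for negative arguments removes most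
  boundary conditions on summation ranges.\<close>

abbreviation S :: "int \<Rightarrow> int \<Rightarrow> (braid \<Rightarrow>\<^sub>0 'k)" where
  "S m n \<equiv> shuffle_elem m n"

lemma shuffle_neg [simp]: "m < 0 \<or> n < 0 \<Longrightarrow> S m n = 0"
  by (subst shuffle_elem.simps) auto

lemma shuffle_rec:
  "m \<noteq> 0 \<or> n \<noteq> 0 \<Longrightarrow> S m n = S (m - 1) n + S m (n - 1) * (B (nat m) 1 \<up> nat (n - 1))"
  by (subst shuffle_elem.simps) auto

lemma shuffle_0_0 [simp]: "S 0 0 = 1"
  by (subst shuffle_elem.simps) auto

lemma shuffle_0_left [simp]: "0 \<le> n \<Longrightarrow> S 0 n = 1"
proof (induction n rule: int_ge_induct)
  case (step n)
  then show ?case by (subst shuffle_rec) (simp_all add: of_braid_0)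
qed simp

lemma shuffle_0_right [simp]: "0 \<le> m \<Longrightarrow> S m 0 = 1"
proof (induction m rule: int_ge_induct)
  case (step m)
  then show ?case by (subst shuffle_rec) simp_all
qed simp

lemma shuffle_Suc_Suc:
  "S (int (Suc m)) (int (Suc n)) =
     S (int m) (int (Suc n)) + S (int (Suc m)) (int n) * (B (Suc m) (Suc 0) \<up> n)"
  by (subst shuffle_rec) (simp_all add: nat_add_distrib)

lemma strands_shuffle_nat: "strands 0 (m + n) (S (int m) (int n))"
proof (induction "m + n" arbitrary: m n rule: less_induct)
  case less
  show ?case
  proof (cases "m = 0 \<or> n = 0")
    case False
    then obtain m' n' where "m = Suc m'" "n = Suc n'"
      by (metis old.nat.exhaust)
    then show ?thesis
      using less[of m' n] less[of m n']
      by (auto simp del: of_nat_Suc simp: shuffle_Suc_Suc intro!: strands.add strands.mult strands_shift[OF strands_B[OF order.refl]]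
          intro: strands_mono)
  qed auto
qed

lemma strands_shuffle:
  assumes "m + n \<le> int k"
  shows "strands 0 k (S m n)"
proof (cases "m < 0 \<or> n < 0")
  case False
  then have "strands 0 k (S (int (nat m)) (int (nat n)))"
    using assms by (intro strands_mono[OF strands_shuffle_nat]) auto
  with False show ?thesis by simp
qed simp

text \<open>Both sides split a word into pieces of lengths \<open>n\<close>, \<open>l\<close>, \<open>m\<close>. In the induction the last letter goes to
  one of the three pieces, and each choice contributes the same on both sides.\<close>

lemma shuffle_coassoc:
  "S (int m) (int (n + l)) * S (int l) (int n) = S (int (l + m)) (int n) * (S (int m) (int l) \<up> n)"
proof (induction "m + n + l" arbitrary: m n l rule: less_induct)
  case less
  show ?case
  proof (cases "m = 0 \<or> n = 0 \<or> l = 0")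
    case True
    then show ?thesis by auto
  next
    case False
    then obtain m' n' l' where mnl: "m = Suc m'" "n = Suc n'" "l = Suc l'"
      by (metis old.nat.exhaust)
    define \<beta>m where "\<beta>m = (B m (Suc 0) \<up> (n + l') :: braid \<Rightarrow>\<^sub>0 'k)"
    define \<beta>l where "\<beta>l = (B l (Suc 0) \<up> n' :: braid \<Rightarrow>\<^sub>0 'k)"
    define \<beta> where "\<beta> = (B (l + m) (Suc 0) \<up> n' :: braid \<Rightarrow>\<^sub>0 'k)"
    have \<beta>: "\<beta>m * \<beta>l = \<beta>"
      by (simp add: \<beta>m_def \<beta>l_def \<beta>_def B_add_left[of l m] shift_mult) (simp add: mnl add_ac)
    have IH1: "S (int m') (int (n + l)) * S (int l) (int n) = S (int (l + m')) (int n) * (S (int m') (int l) \<up> n)"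
      and IH2: "S (int m) (int (n + l')) * S (int l') (int n) = S (int (l' + m)) (int n) * (S (int m) (int l') \<up> n)"
      and IH3: "S (int m) (int (n' + l)) * S (int l) (int n') = S (int (l + m)) (int n') * (S (int m) (int l) \<up> n')"
      by (rule less; simp add: mnl)+
    have c1: "S (int l') (int n) * \<beta>m = \<beta>m * S (int l') (int n)"
      unfolding \<beta>m_def
      by (rule strands_commute[OF strands_shuffle[of _ _ "n + l'"]
            strands_shift[OF strands_B[OF order.refl] order.refl order.refl]]) auto
    have c2: "(S (int m) (int l) \<up> n') * \<beta> = \<beta> * (S (int m) (int l) \<up> n)"
      using arg_cong[OF B_natural_left[OF strands_shuffle_nat[of m l], of "Suc 0"], of "\<lambda>x. x \<up> n'"]
      by (simp add: \<beta>_def shift_mult mnl add_ac)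
    have e1: "S (int m) (int (n + l)) = S (int m') (int (n + l)) + S (int m) (int (n + l')) * \<beta>m"
      using shuffle_Suc_Suc[of m' "n + l'"] by (simp add: mnl \<beta>m_def)
    have e2: "S (int l) (int n) = S (int l') (int n) + S (int l) (int n') * \<beta>l"
      using shuffle_Suc_Suc[of l' n'] by (simp add: mnl \<beta>l_def)
    have e3: "S (int m) (int l) = S (int m') (int l) + S (int m) (int l') * (B m (Suc 0) \<up> l')"
      using shuffle_Suc_Suc[of m' l'] by (simp add: mnl)
    have e4: "S (int (l + m)) (int n) = S (int (l + m')) (int n) + S (int (l + m)) (int n') * \<beta>"
      using shuffle_Suc_Suc[of "l + m'" n'] by (simp add: mnl \<beta>_def add_ac)
    have nl: "n + l' = n' + l" "l' + m = l + m'" by (auto simp: mnl)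
    have "S (int m) (int (n + l)) * S (int l) (int n) =
       S (int m') (int (n + l)) * S (int l) (int n)
       + S (int m) (int (n + l')) * \<beta>m * S (int l') (int n) + S (int m) (int (n + l')) * \<beta>m * S (int l) (int n') * \<beta>l"
      unfolding e1 distrib_right by (subst (2) e2) (simp add: distrib_left mult.assoc)
    also have "S (int m) (int (n + l')) * \<beta>m * S (int l') (int n) = S (int (l' + m)) (int n) * (S (int m) (int l') \<up> n) * \<beta>m"
      unfolding IH2[symmetric] by (simp add: mult.assoc c1)
    also have "S (int m) (int (n + l')) * \<beta>m * S (int l) (int n') * \<beta>l = S (int (l + m)) (int n') * \<beta> * (S (int m) (int l) \<up> n)"
    proof -
      have *: "\<beta>m * S (int l) (int n') = S (int l) (int n') * \<beta>m"
        unfolding \<beta>m_def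
        by (rule strands_commute[symmetric, OF strands_shuffle[of _ _ "n + l'"]
              strands_shift[OF strands_B[OF order.refl] order.refl order.refl]]) (auto simp: mnl)
      have "S (int m) (int (n + l')) * \<beta>m * S (int l) (int n') * \<beta>l
          = S (int m) (int (n + l')) * S (int l) (int n') * (\<beta>m * \<beta>l)"
        by (simp only: mult.assoc mult_left_assoc[OF *])
      then show ?thesis
        by (simp only: nl IH3 \<beta> mult.assoc c2)
    qed
    also have "S (int m') (int (n + l)) * S (int l) (int n) + S (int (l' + m)) (int n) * (S (int m) (int l') \<up> n) * \<beta>m
        + S (int (l + m)) (int n') * \<beta> * (S (int m) (int l) \<up> n) = S (int (l + m)) (int n) * (S (int m) (int l) \<up> n)"
    proof -
      have "S (int m) (int l) \<up> n = S (int m') (int l) \<up> n + (S (int m) (int l') \<up> n) * \<beta>m"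
        by (subst e3) (simp add: shift_add shift_mult \<beta>m_def add_ac)
      then show ?thesis
        by (simp only: IH1 nl e4 distrib_left distrib_right mult.assoc) (simp only: add_ac)
    qed
    finally show ?thesis .
  qed
qed

text \<open>The defining recursion of \<open>S\<close> decides where the last letter goes; this one decides where the first
  letter goes: it stays in front, or it crosses all \<open>f\<close> letters of the left piece.\<close>

lemma shuffle_first_rec:
  assumes "h \<noteq> 0 \<or> f \<noteq> 0"
  shows "S (int h) (int f) = (S (int h) (int f - 1) \<up> Suc 0) + (S (int h - 1) (int f) \<up> Suc 0) * B (Suc 0) f"
  using assms
proof (induction "h + f" arbitrary: h f rule: less_induct)
  case less
  show ?case
  proof (cases "h = 0 \<or> f = 0")
    case True
    then show ?thesis
    proof
      assume "h = 0"
      with less.prems obtain f' where "f = Suc f'" by (cases f) auto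
      with \<open>h = 0\<close> show ?thesis by simp
    next
      assume "f = 0"
      with less.prems obtain h' where "h = Suc h'" by (cases h) auto
      with \<open>f = 0\<close> show ?thesis by simp
    qed
  next
    case False
    then obtain h' f' where hf: "h = Suc h'" "f = Suc f'"
      by (metis old.nat.exhaust)
    define \<beta> where "\<beta> = (B h (Suc 0) \<up> f' :: braid \<Rightarrow>\<^sub>0 'k)"
    define \<beta>' where "\<beta>' = (B h' (Suc 0) \<up> f :: braid \<Rightarrow>\<^sub>0 'k)"
    have IH1: "S (int h') (int f) = (S (int h') (int f') \<up> Suc 0) + (S (int h' - 1) (int f) \<up> Suc 0) * B (Suc 0) f"
      using less.hyps[of h' f] by (simp add: hf)
    have IH2: "S (int h) (int f') = (S (int h) (int f' - 1) \<up> Suc 0) + (S (int h') (int f') \<up> Suc 0) * B (Suc 0) f'"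
      using less.hyps[of h f'] by (simp add: hf)
    have e1: "S (int h) (int f) = S (int h') (int f) + S (int h) (int f') * \<beta>"
      using shuffle_Suc_Suc[of h' f'] by (simp add: hf \<beta>_def)
    have e2: "S (int h) (int f') \<up> Suc 0 = (S (int h') (int f') \<up> Suc 0) + (S (int h) (int f' - 1) \<up> Suc 0) * \<beta>"
      using shuffle_rec[of "int h" "int f'"]
      by (cases f') (simp_all add: hf \<beta>_def shift_add shift_mult nat_add_distrib)
    have e3: "S (int h') (int f) \<up> Suc 0 = (S (int h' - 1) (int f) \<up> Suc 0) + (S (int h') (int f') \<up> Suc 0) * \<beta>'"
      using shuffle_rec[of "int h'" "int f"]
      by (simp add: hf \<beta>'_def shift_add shift_mult)
    have c: "B (Suc 0) f' * \<beta> = \<beta>' * B (Suc 0) f"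
    proof -
      have *: "B (Suc 0) f' * \<beta>' = \<beta>' * (B (Suc 0) f' :: braid \<Rightarrow>\<^sub>0 'k)"
        unfolding \<beta>'_def
        by (rule strands_commute[OF strands_B[of _ _ f] strands_shift[OF strands_B[OF order.refl] order.refl order.refl]])
          (simp_all add: hf)
      have "\<beta> = \<beta>' * (B (Suc 0) (Suc 0) \<up> f')"
        using B_add_left[of "Suc 0" h' "Suc 0"]
        by (simp add: \<beta>_def \<beta>'_def hf shift_mult)
      then show ?thesis
        using B_add_right[of "Suc 0" f' "Suc 0"]
        by (simp add: hf mult_left_assoc[OF *] mult.assoc)
    qed
    have "S (int h) (int f) =
        (S (int h') (int f') \<up> Suc 0) + (S (int h' - 1) (int f) \<up> Suc 0) * B (Suc 0) f
        + ((S (int h) (int f' - 1) \<up> Suc 0) + (S (int h') (int f') \<up> Suc 0) * B (Suc 0) f') * \<beta>"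
      unfolding e1 by (simp only: IH1 IH2)
    then have "S (int h) (int f) = (S (int h) (int f') \<up> Suc 0) + (S (int h') (int f) \<up> Suc 0) * B (Suc 0) f"
      by (simp only: e2 e3 distrib_right mult.assoc c add_ac)
    then show ?thesis by (simp add: hf)
  qed
qed

section \<open>The Yetter--Drinfeld condition\<close>

abbreviation p :: "'k \<Rightarrow> nat \<Rightarrow> nat \<Rightarrow> (braid \<Rightarrow>\<^sub>0 'k)" where
  "p t k n \<equiv> pochhammer_elem k n 1 t"

lemma pochhammer_0 [simp]: "p t k 0 = 1"
  by (simp add: pochhammer_elem_def)

lemma pochhammer_Suc: "p t k (Suc n) = p t k n * (1 - B (k + n) (Suc 0) * scalar t)"
  by (simp add: pochhammer_elem_def)

lemma pochhammer_add: "p t k (m + n) = p t k m * p t (k + m) n"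
  by (induction n) (simp_all add: pochhammer_Suc mult.assoc add.assoc)

lemma strands_pochhammer: "k + n \<le> l \<Longrightarrow> strands 0 l (p t k n)"
  by (induction n)
    (auto simp: pochhammer_Suc intro!: strands.mult strands_diff strands.scalar strands_B)

text \<open>The Yetter--Drinfeld condition for a word \<open>x\<close> of length \<open>N\<close> and a single letter \<open>y\<close>. On the left are
  \<open>(x \<triangleleft> y)\<^sub>1 \<otimes> (x \<triangleleft> y)\<^sub>2\<close> and \<open>t x\<^sub>1 \<otimes> y x\<^sub>2\<close>, on the right \<open>x\<^sub>1 \<otimes> x\<^sub>2 y\<close> and \<open>(x\<^sub>1 \<triangleleft> y) \<otimes> x\<^sub>2\<close>. In the
  coproduct of \<open>t y x\<close> the part with \<open>y\<close> in the second piece cancels the extra term on the left, which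
  is the reason for the twist.\<close>

lemma yetter_drinfeld_letter:
  assumes "int f + h = int N + 1"
  shows "(1 - B N (Suc 0) * scalar t) * S h (int f) + scalar t * B N (Suc 0) * (S (h - 1) (int f) \<up> Suc 0) * B (Suc 0) f
    = S (h - 1) (int f) + S h (int f - 1) * (B (nat h) (Suc 0) \<up> (f - 1)) * (1 - B (f - 1) (Suc 0) * scalar t)"
proof (cases "h < 0")
  case False
  then obtain h' where h: "h = int h'" by (metis nat_eq_iff linorder_not_less)
  let ?B = "B N (Suc 0) :: braid \<Rightarrow>\<^sub>0 'k"
  have hf: "h' \<noteq> 0 \<or> f \<noteq> 0" using assms h by auto
  let ?X = "S h (int f - 1)" and ?Y = "(S (h - 1) (int f) \<up> Suc 0) * B (Suc 0) f"
  let ?Z = "?X * (B (nat h) (Suc 0) \<up> (f - 1))"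
  have first: "S h (int f) = (?X \<up> Suc 0) + ?Y"
    unfolding h by (rule shuffle_first_rec[OF hf])
  have last: "S h (int f) = S (h - 1) (int f) + ?Z"
  proof -
    have "nat (int f - 1) = f - 1" by arith
    then show ?thesis
      using shuffle_rec[of h "int f"] hf h by simp
  qed
  have "?B * (?X \<up> Suc 0) = ?X * ?B"
    by (rule B_natural_left[symmetric, OF strands_shuffle]) (use assms in auto)
  also have "\<dots> = ?Z * B (f - 1) (Suc 0)"
  proof (cases f)
    case (Suc f')
    then have "N = f' + h'" using assms h by simp
    then show ?thesis using Suc h by (simp add: B_add_left mult.assoc)
  qed simp
  finally have BX: "?B * (?X \<up> Suc 0) = ?Z * B (f - 1) (Suc 0)" .
  have "(1 - ?B * scalar t) * S h (int f) + scalar t * ?B * (S (h - 1) (int f) \<up> Suc 0) * B (Suc 0) f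
      = S h (int f) - scalar t * (?B * S h (int f)) + scalar t * (?B * ?Y)"
    by (simp add: left_diff_distrib scalar_central[of ?B] mult.assoc)
  also have "scalar t * (?B * S h (int f)) = scalar t * (?B * (?X \<up> Suc 0)) + scalar t * (?B * ?Y)"
    unfolding first by (simp add: distrib_left)
  finally have "(1 - ?B * scalar t) * S h (int f) + scalar t * ?B * (S (h - 1) (int f) \<up> Suc 0) * B (Suc 0) f
      = S (h - 1) (int f) + (?Z - scalar t * (?Z * B (f - 1) (Suc 0)))"
    by (simp add: BX last)
  also have "?Z - scalar t * (?Z * B (f - 1) (Suc 0)) = ?Z * (1 - B (f - 1) (Suc 0) * scalar t)"
    by (simp add: right_diff_distrib scalar_central[of ?Z] mult_left_assoc[OF scalar_central]
        scalar_central[of "B _ _"] mult.assoc)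
  finally show ?thesis .
qed simp


text \<open>The summands of the two sides of the Yetter--Drinfeld condition for words \<open>x\<close>, \<open>y\<close> of lengths \<open>b\<close>, \<open>c\<close>,
  in the component whose first tensor factor has length \<open>f\<close>. In \<open>yd_left\<close> the piece \<open>y\<^sub>1\<close> has length \<open>k\<close>, in
  \<open>yd_right\<close> the piece \<open>x\<^sub>1\<close> has length \<open>j\<close>.\<close>

definition yd_left :: "'k \<Rightarrow> nat \<Rightarrow> nat \<Rightarrow> nat \<Rightarrow> nat \<Rightarrow> (braid \<Rightarrow>\<^sub>0 'k)" where
  "yd_left t b c f k = scalar (t ^ k) * (S (int c - int k) (int k) \<up> b) * B b k * (p t b (c - k) \<up> k)
     * (S (int b + int c - int f - int k) (int f) \<up> k) * B k f"

lemma yd_left_eq_0: "b + c < k + f \<Longrightarrow> yd_left t b c f k = 0"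
  by (simp add: yd_left_def)

definition yd_right :: "'k \<Rightarrow> nat \<Rightarrow> nat \<Rightarrow> nat \<Rightarrow> nat \<Rightarrow> (braid \<Rightarrow>\<^sub>0 'k)" where
  "yd_right t b c f j = S (int b - int j) (int j) * (S (int c + int j - int f) (int f - int j) \<up> b)
     * (B (b - j) (f - j) \<up> j) * p t j (f - j)"

lemma yd_right_eq_0: "b < j \<or> c + j < f \<Longrightarrow> yd_right t b c f j = 0"
  by (auto simp: yd_right_def)

text \<open>The effect of one more letter \<open>z\<close> at the end of \<open>y\<close> that ends up acting on the first tensor factor
  of length \<open>f\<close>: it crosses the second factor and then acts.\<close>

definition yd_factor :: "'k \<Rightarrow> nat \<Rightarrow> nat \<Rightarrow> nat \<Rightarrow> (braid \<Rightarrow>\<^sub>0 'k)" where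
  "yd_factor t b c f = (B (b + c - f) (Suc 0) \<up> f) * (1 - B f (Suc 0) * scalar t)"

text \<open>When \<open>y\<close> is extended by a letter \<open>z\<close>, the letter goes to the acting piece or to the front piece of \<open>y\<close>.
  These two terms are the left-hand side of the one-letter condition for \<open>x \<triangleleft> y\<^sub>2\<close> and \<open>z\<close>. Its right-hand
  side has one term in which \<open>z\<close> is appended to the second factor, and one in which it acts on the first.\<close>

lemma yd_left_step_term:
  assumes "k \<le> c"
  shows "scalar (t ^ k) * (S (int c - int k) (int k) \<up> b) * B b k * (p t b (Suc c - k) \<up> k)
        * (S (int b + int (Suc c) - int f - int k) (int f) \<up> k) * B k f
      + scalar (t ^ Suc k) * ((S (int c - int k) (int k) * (B (c - k) (Suc 0) \<up> k)) \<up> b) * B b (Suc k)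
        * (p t b (c - k) \<up> Suc k) * (S (int b + int c - int f - int k) (int f) \<up> Suc k) * B (Suc k) f
    = yd_left t b c f k + (if f = 0 then 0 else yd_left t b c (f - 1) k * yd_factor t b c (f - 1))"
    (is "?U + ?V = _")
proof -
  define s where "s = S (int c - int k) (int k) \<up> b"
  define pp where "pp = p t b (c - k)"
  define N where "N = b + c - k"
  define h where "h = int b + int (Suc c) - int f - int k"
  define X where "X = scalar (t ^ k) * s * B b k * (pp \<up> k)"
  have N: "N = b + (c - k)" using assms by (simp add: N_def)
  have h1: "h - 1 = int b + int c - int f - int k" by (simp add: h_def)
  have c1: "(B (c - k) (Suc 0) \<up> (k + b)) * B b k = B b k * (B (c - k) (Suc 0) \<up> (k + b))"
    using shifts_commute[OF strands_B[OF order.refl, of b k] strands_B[OF order.refl, of "c - k" "Suc 0"], of 0 "k + b"]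
    by simp
  have c2: "(B N (Suc 0) \<up> k) * (pp \<up> Suc k) = (pp \<up> k) * (B N (Suc 0) \<up> k)"
  proof -
    have "strands 0 N pp"
      unfolding pp_def by (rule strands_pochhammer) (simp add: N)
    from B_natural_left[OF this, of "Suc 0"] have "pp * B N (Suc 0) = B N (Suc 0) * (pp \<up> Suc 0)" .
    from arg_cong[OF this, of "\<lambda>x. x \<up> k"] show ?thesis
      by (simp add: shift_mult)
  qed
  have BN: "B N (Suc 0) \<up> k = (B (c - k) (Suc 0) \<up> (k + b)) * (B b (Suc 0) \<up> k)"
    by (simp add: N B_add_left shift_mult add_ac)
  have Bk: "B (Suc k) f = (B (Suc 0) f \<up> k) * B k f"
    using B_add_left[of k "Suc 0" f] by simp
  have Bb: "B b (Suc k) = B b k * (B b (Suc 0) \<up> k)"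
    using B_add_right[of b k "Suc 0"] by simp
  have U: "?U = X * (((1 - B N (Suc 0) * scalar t) * S h (int f)) \<up> k) * B k f"
    using assms by (simp add: X_def s_def pp_def h_def N Suc_diff_le pochhammer_Suc shift_mult mult.assoc)
  have "?V = scalar (t ^ k) * (scalar t * (s * (B (c - k) (Suc 0) \<up> (k + b)) * B b k * (B b (Suc 0) \<up> k)
        * (pp \<up> Suc k) * (S (h - 1) (int f) \<up> Suc k))) * (B (Suc 0) f \<up> k) * B k f"
    unfolding Bk Bb h1 by (simp add: s_def pp_def shift_mult scalar_mult scalar_central[of "scalar t"] mult.assoc)
  also have "s * (B (c - k) (Suc 0) \<up> (k + b)) * B b k * (B b (Suc 0) \<up> k) * (pp \<up> Suc k)
      = s * B b k * (pp \<up> k) * (B N (Suc 0) \<up> k)"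
  proof -
    have "s * (B (c - k) (Suc 0) \<up> (k + b)) * B b k * (B b (Suc 0) \<up> k) * (pp \<up> Suc k)
        = s * B b k * ((B N (Suc 0) \<up> k) * (pp \<up> Suc k))"
      by (simp only: BN mult.assoc mult_left_assoc[OF c1])
    then show ?thesis by (simp only: c2 mult.assoc)
  qed
  also have "scalar (t ^ k) * (scalar t * (s * B b k * (pp \<up> k) * (B N (Suc 0) \<up> k) * (S (h - 1) (int f) \<up> Suc k)))
        * (B (Suc 0) f \<up> k) * B k f
      = X * ((scalar t * B N (Suc 0) * (S (h - 1) (int f) \<up> Suc 0) * B (Suc 0) f) \<up> k) * B k f"
  proof -
    define Y where "Y = s * B b k * (pp \<up> k)"
    have "scalar t * (Y * z) = Y * (scalar t * z)" for z
      using scalar_central[of Y t] by (metis mult.assoc)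
    then show ?thesis
      by (simp add: X_def shift_mult Y_def[symmetric] mult.assoc[of "scalar (t ^ k)", symmetric]) (simp add: Y_def mult.assoc)
  qed
  finally have V: "?V = X * ((scalar t * B N (Suc 0) * (S (h - 1) (int f) \<up> Suc 0) * B (Suc 0) f) \<up> k) * B k f" .
  have "int f + h = int N + 1" using assms by (simp add: h_def N)
  note letter = yetter_drinfeld_letter[OF this, of t]
  have UV: "?U + ?V = X * (S (h - 1) (int f) \<up> k) * B k f
      + X * ((S h (int f - 1) * (B (nat h) (Suc 0) \<up> (f - 1)) * (1 - B (f - 1) (Suc 0) * scalar t)) \<up> k) * B k f"
    unfolding U V distrib_right[symmetric] distrib_left[symmetric] shift_add[symmetric] letter ..
  have "X * (S (h - 1) (int f) \<up> k) * B k f = yd_left t b c f k"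
    by (simp add: yd_left_def X_def s_def pp_def h1 mult.assoc)
  moreover have "X * ((S h (int f - 1) * (B (nat h) (Suc 0) \<up> (f - 1)) * (1 - B (f - 1) (Suc 0) * scalar t)) \<up> k) * B k f
      = (if f = 0 then 0 else yd_left t b c (f - 1) k * yd_factor t b c (f - 1))"
  proof (cases "f = 0 \<or> h < 0")
    case True
    then show ?thesis
      by (auto simp: yd_left_def h_def)
  next
    case False
    then obtain f' where f: "f = Suc f'" by (cases f) auto
    have h2: "h = int b + int c - int f' - int k" by (simp add: h_def f)
    from False have h: "nat h + k = b + c - f'" "0 \<le> h" using assms by (auto simp: h_def f)
    define Q where "Q = 1 - B f' (Suc 0) * scalar t"
    have "strands 0 f Q"
      by (auto simp: Q_def f intro!: strands_diff strands.mult strands.scalar strands_B)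
    then have c3: "(Q \<up> k) * B k f = B k f * Q"
      by (rule B_natural_right)
    have c4: "(B (nat h) (Suc 0) \<up> (f' + k)) * B k f' = B k f' * (B (nat h) (Suc 0) \<up> (f' + k))"
      using shifts_commute[OF strands_B[OF order.refl, of k f'] strands_B[OF order.refl, of "nat h" "Suc 0"], of 0 "f' + k"]
      by simp
    have Bh: "(B (nat h) (Suc 0) \<up> (f' + k)) * B k f = B k f' * (B (b + c - f') (Suc 0) \<up> f')"
      using B_add_right[of k f' "Suc 0"] B_add_left[of k "nat h" "Suc 0"] h
      by (simp add: f mult_left_assoc[OF c4] mult.assoc shift_mult add_ac)
    have "(S h (int f') \<up> k) * (B (nat h) (Suc 0) \<up> (f' + k)) * (Q \<up> k) * B k f
       = (S h (int f') \<up> k) * B k f' * (B (b + c - f') (Suc 0) \<up> f') * Q"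
      by (simp only: mult.assoc c3 mult_left_assoc[OF Bh])
    then show ?thesis
      by (simp add: f Q_def[symmetric] yd_factor_def yd_left_def X_def s_def pp_def h2 shift_mult mult.assoc)
  qed
  ultimately show ?thesis unfolding UV by simp
qed

lemma yd_left_step:
  "(\<Sum>k\<le>Suc c. yd_left t b (Suc c) f k) = (\<Sum>k\<le>c. yd_left t b c f k)
     + (if f = 0 then 0 else (\<Sum>k\<le>c. yd_left t b c (f - 1) k) * yd_factor t b c (f - 1))"
proof -
  define U where "U k = scalar (t ^ k) * (S (int c - int k) (int k) \<up> b) * B b k * (p t b (Suc c - k) \<up> k)
        * (S (int b + int (Suc c) - int f - int k) (int f) \<up> k) * B k f" for k
  define V where "V k = scalar (t ^ k) * ((S (int (Suc c) - int k) (int k - 1) * (B (Suc c - k) (Suc 0) \<up> (k - 1))) \<up> b)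
        * B b k * (p t b (Suc c - k) \<up> k) * (S (int b + int (Suc c) - int f - int k) (int f) \<up> k) * B k f" for k
  have UV: "yd_left t b (Suc c) f k = U k + V k" for k
  proof -
    have "nat (int k - 1) = k - 1" "nat (int (Suc c) - int k) = Suc c - k" by arith+
    then have "S (int (Suc c) - int k) (int k) =
        S (int c - int k) (int k) + S (int (Suc c) - int k) (int k - 1) * (B (Suc c - k) (Suc 0) \<up> (k - 1))"
      by (subst shuffle_rec) auto
    then show ?thesis
      by (simp add: yd_left_def U_def V_def shift_add distrib_left distrib_right)
  qed
  have "(\<Sum>k\<le>Suc c. U k) = (\<Sum>k\<le>c. U k)"
    by (simp add: U_def)
  moreover have "(\<Sum>k\<le>Suc c. V k) = (\<Sum>k\<le>c. V (Suc k))"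
    by (subst sum.atMost_Suc_shift) (simp add: V_def)
  ultimately have "(\<Sum>k\<le>Suc c. yd_left t b (Suc c) f k) = (\<Sum>k\<le>c. U k + V (Suc k))"
    by (simp only: UV sum.distrib)
  also have "\<dots> = (\<Sum>k\<le>c. yd_left t b c f k + (if f = 0 then 0 else yd_left t b c (f - 1) k * yd_factor t b c (f - 1)))"
    by (rule sum.cong[OF HOL.refl], subst yd_left_step_term[symmetric])
      (simp_all add: U_def V_def algebra_simps)
  finally show ?thesis
    by (simp add: sum.distrib sum_distrib_right)
qed

text \<open>Here the two terms come directly from the last-letter recursion for the coproduct of \<open>y\<close>.\<close>

lemma yd_right_step_term:
  assumes "j \<le> f"
  shows "yd_right t b (Suc c) f j = yd_right t b c f j
     + (if j = f then 0 else yd_right t b c (f - 1) j * yd_factor t b c (f - 1))"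
proof (cases "b < j \<or> j = f \<or> int c + 1 + int j < int f")
  case True
  then show ?thesis by (auto simp: yd_right_def)
next
  case False
  then obtain f' where f: "f = Suc f'" using assms by (cases f) auto
  define m where "m = c + j - f'"
  define n where "n = f' - j"
  have j: "j \<le> b" "j \<le> f'" "f' \<le> c + j" using False assms f by auto
  have m: "int m = int c + int j - int f'" and n: "int n = int f' - int j" "f - j = Suc n"
    using j by (auto simp: m_def n_def f)
  define s where "s = S (int b - int j) (int j)"
  have e1: "S (int (Suc c) + int j - int f) (int f - int j)
      = S (int c + int j - int f) (int f - int j) + S (int m) (int n) * (B m (Suc 0) \<up> n)"
  proof -
    have "int (Suc c) + int j - int f = int m" "int c + int j - int f = int m - 1" "int f - int j = 1 + int n"
      using m n by (simp_all add: f)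
    then show ?thesis
      by (simp only:) (subst shuffle_rec, simp_all)
  qed
  have e2: "B (b - j) (f - j) \<up> j = (B (b - j) n \<up> j) * (B (b - j) (Suc 0) \<up> f')"
    using B_add_right[of "b - j" n "Suc 0"] j by (simp add: n shift_mult n_def)
  have e3: "p t j (f - j) = p t j n * (1 - B f' (Suc 0) * scalar t)"
    using j by (simp add: n pochhammer_Suc) (simp add: n_def)
  have c1: "(B m (Suc 0) \<up> (n + b)) * (B (b - j) n \<up> j) = (B (b - j) n \<up> j) * (B m (Suc 0) \<up> (n + b))"
    by (rule shifts_commute[symmetric, OF strands_B[OF order.refl] strands_B[OF order.refl]]) (use j in auto)
  have c2: "(B m (Suc 0) \<up> (n + b)) * (B (b - j) (Suc 0) \<up> f') = B (b + c - f') (Suc 0) \<up> f'"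
  proof -
    have "b + c - f' = (b - j) + m" "n + b = b - j + f'" using j by (auto simp: m_def n_def)
    then show ?thesis by (simp add: B_add_left shift_mult)
  qed
  have c3: "(B (b + c - f') (Suc 0) \<up> f') * p t j n = p t j n * (B (b + c - f') (Suc 0) \<up> f')"
    using shifts_commute[OF strands_pochhammer[OF order.refl, of j n t] strands_B[OF order.refl, of "b + c - f'" "Suc 0"], of 0 f'] j
    by (simp add: n_def)
  have "yd_right t b (Suc c) f j = yd_right t b c f j
     + s * (S (int m) (int n) \<up> b) * (B m (Suc 0) \<up> (n + b)) * (B (b - j) n \<up> j) * (B (b - j) (Suc 0) \<up> f')
       * p t j n * (1 - B f' (Suc 0) * scalar t)"
    unfolding yd_right_def e1 e2 e3 by (simp only: shift_add shift_mult shift_shift distrib_left distrib_right mult.assoc s_def)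
  also have "s * (S (int m) (int n) \<up> b) * (B m (Suc 0) \<up> (n + b)) * (B (b - j) n \<up> j) * (B (b - j) (Suc 0) \<up> f')
       * p t j n * (1 - B f' (Suc 0) * scalar t)
     = s * (S (int m) (int n) \<up> b) * (B (b - j) n \<up> j) * p t j n * (B (b + c - f') (Suc 0) \<up> f') * (1 - B f' (Suc 0) * scalar t)"
    by (simp only: mult.assoc mult_left_assoc[OF c1] mult_left_assoc[OF c2] mult_left_assoc[OF c3])
  also have "\<dots> = yd_right t b c f' j * yd_factor t b c f'"
    by (simp add: yd_right_def yd_factor_def s_def m n(1) n_def[symmetric] mult.assoc)
  finally show ?thesis using j by (simp add: f)
qed

text \<open>Both sides satisfy the same recursion in \<open>c\<close>.\<close>

lemma yetter_drinfeld: "(\<Sum>k\<le>c. yd_left t b c f k) = (\<Sum>j\<le>f. yd_right t b c f j)"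
proof (induction c arbitrary: f)
  case 0
  have "(\<Sum>j\<le>f. yd_right t b 0 f j) = (\<Sum>j\<in>{f}. yd_right t b 0 f j)"
    by (rule sum.mono_neutral_right) (auto simp: yd_right_def)
  then show ?case by (simp add: yd_left_def yd_right_def)
next
  case (Suc c)
  have "(\<Sum>j\<le>f. yd_right t b (Suc c) f j) = (\<Sum>j\<le>f. yd_right t b c f j)
      + (\<Sum>j\<le>f. if j = f then 0 else yd_right t b c (f - 1) j * yd_factor t b c (f - 1))"
    unfolding sum.distrib[symmetric] by (rule sum.cong) (simp_all add: yd_right_step_term)
  also have "(\<Sum>j\<le>f. if j = f then 0 else yd_right t b c (f - 1) j * yd_factor t b c (f - 1))
      = (if f = 0 then 0 else (\<Sum>j\<le>f - 1. yd_right t b c (f - 1) j) * yd_factor t b c (f - 1))"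
  proof (cases f)
    case (Suc f')
    have "(\<Sum>j\<le>f'. if j = Suc f' then 0 else yd_right t b c f' j * yd_factor t b c f')
       = (\<Sum>j\<le>f'. yd_right t b c f' j * yd_factor t b c f')"
      by (rule sum.cong) auto
    then show ?thesis by (simp add: Suc sum_distrib_right)
  qed simp
  finally show ?case
    by (simp only: yd_left_step Suc)
qed


section \<open>The Yang--Baxter equation\<close>

definition unscaled_A :: "'k \<Rightarrow> nat \<Rightarrow> nat \<Rightarrow> nat \<Rightarrow> (braid \<Rightarrow>\<^sub>0 'k)" where
  "unscaled_A t a b c = (S (int b - int c) (int c) \<up> a) * B a c * (p t a (b - c) \<up> c)"

lemma A_elem_eq_unscaled: "A_elem q a b c = scalar (q powi (1 - int a - int c)) * unscaled_A (q powi (- 2)) a b c"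
  by (simp add: A_elem_def unscaled_A_def p_elem_def mult.assoc)

text \<open>In \<open>(w, x, y) \<mapsto> (w, y\<^sub>1, x \<triangleleft> y\<^sub>2) \<mapsto> (y\<^sub>1\<^sub>1, w \<triangleleft> y\<^sub>1\<^sub>2, x \<triangleleft> y\<^sub>2) \<mapsto> \<cdots>\<close> coassociativity gives
  \<open>(y\<^sub>1, (x \<triangleleft> y\<^sub>3)\<^sub>1, w \<triangleleft> y\<^sub>2 (x \<triangleleft> y\<^sub>3)\<^sub>2)\<close>. Hence every summand is one of the summands of the
  Yetter--Drinfeld condition, placed between factors that do not depend on \<open>k\<close>.\<close>

lemma wrap_yd_left:
  assumes "k \<le> c" "k + f \<le> b + c"
  shows "scalar (t ^ k) * ((unscaled_A t b (e + c) (e + k) \<up> a) * unscaled_A t a (e + k) e * (unscaled_A t (a + k) (b + c - k) f \<up> e))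
    = (S (int c) (int e) \<up> (a + b)) * B (a + b) e * (yd_left t b c f k \<up> (a + e)) * (B a f \<up> e)
      * (p t a (b + c - f) \<up> (e + f))"
proof -
  \<comment> \<open>\<open>T\<close> are the factors of the left-hand side in order, \<open>Z\<close> and \<open>Y\<close> those of the right-hand side; a prime
    marks a factor after it has been moved through a crossing.\<close>
  define r where "r = b + c - k - f"
  define m where "m = c - k"
  have c: "c = m + k" and r: "b + c = r + k + f" using assms by (auto simp: m_def r_def)
  define T1 T2 T3 T4 T5 T6 T7 T8 T9
    where T: "T1 = S (int m) (int (e + k)) \<up> (a + b)" "T2 = B b (e + k) \<up> a" "T3 = p t b m \<up> (e + k + a)"
      "T4 = S (int k) (int e) \<up> a" "T5 = (B a e :: braid \<Rightarrow>\<^sub>0 'k)" "T6 = p t a k \<up> e"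
      "T7 = S (int r) (int f) \<up> (e + k + a)" "T8 = B (a + k) f \<up> e" "T9 = p t (a + k) r \<up> (e + f)"
  define T4' T6' Z1 Z2 Z3 Z4
    where T': "T4' = S (int k) (int e) \<up> (a + b)" "T6' = p t a k \<up> (e + f)"
    and Z: "Z1 = S (int c) (int e) \<up> (a + b)" "Z2 = (B (a + b) e :: braid \<Rightarrow>\<^sub>0 'k)"
      "Z3 = B a f \<up> e" "Z4 = p t a (b + c - f) \<up> (e + f)"
  define Y1 Y2 Y5
    where Y: "Y1 = S (int m) (int k) \<up> (a + b + e)" "Y2 = B b k \<up> (a + e)" "Y5 = B k f \<up> (a + e)"
  have lhs: "(unscaled_A t b (e + c) (e + k) \<up> a) * unscaled_A t a (e + k) e * (unscaled_A t (a + k) (b + c - k) f \<up> e)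
      = T1 * T2 * T3 * T4 * T5 * T6 * T7 * T8 * T9"
  proof -
    have "int (e + c) - int (e + k) = int m" "e + c - (e + k) = m"
      "int (e + k) - int e = int k" "e + k - e = k"
      "int (b + c - k) - int f = int r" "b + c - k - f = r"
      using assms by (auto simp: m_def r_def)
    then show ?thesis
      unfolding unscaled_A_def T by (simp only: shift_mult shift_shift mult.assoc add_ac)
  qed
  have rhs: "yd_left t b c f k \<up> (a + e) = scalar (t ^ k) * (Y1 * Y2 * T3 * T7 * Y5)"
  proof -
    have "int c - int k = int m" "c - k = m" "int b + int c - int f - int k = int r"
      using assms by (auto simp: m_def r_def)
    then show ?thesis
      unfolding yd_left_def T Y by (simp only: shift_mult shift_shift shift_scalar mult.assoc add_ac)
  qed
  have 1: "T3 * T4 = T4 * T3" "T3 * T5 = T5 * T3" "T3 * T6 = T6 * T3"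
    using shifts_commute[OF strands_shuffle_nat[of k e] strands_pochhammer[OF order.refl, of b m t], of a "e + k + a"]
      shifts_commute[OF strands_B[OF order.refl, of a e] strands_pochhammer[OF order.refl, of b m t], of 0 "e + k + a"]
      shifts_commute[OF strands_pochhammer[OF order.refl, of a k t] strands_pochhammer[OF order.refl, of b m t], of e "e + k + a"]
    unfolding T by simp_all
  have 2: "T2 * T4 = T4' * T2"
    using arg_cong[OF B_natural_right[OF strands_shuffle[of "int k" "int e" "e + k"], of b], of "\<lambda>x. x \<up> a"]
    unfolding T T' by (simp add: shift_mult add_ac)
  have 3: "T1 * T4' = Z1 * Y1"
    using arg_cong[OF shuffle_coassoc[of m e k], of "\<lambda>x. x \<up> (a + b)"]
    unfolding T T' Z Y by (simp add: shift_mult c add_ac)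
  have 4: "T2 * T5 = Z2 * Y2"
  proof -
    have "Y2 * T5 = T5 * Y2"
      using shifts_commute[OF strands_B[OF order.refl, of a e] strands_B[OF order.refl, of b k], of 0 "a + e"]
      unfolding T Y by simp
    moreover have "T2 = (B b e \<up> a) * Y2" "Z2 = (B b e \<up> a) * T5"
      unfolding T Y Z by (simp_all add: B_add_left B_add_right shift_mult add_ac)
    ultimately show ?thesis by (simp add: mult.assoc)
  qed
  have 5: "Y1 * Z2 = Z2 * Y1"
    using shifts_commute[OF strands_B[OF order.refl, of "a + b" e] strands_shuffle_nat[of m k], of 0 "a + b + e"]
    unfolding Y Z by simp
  have 6: "T6 * T3 = T3 * T6" "T6 * T7 = T7 * T6"
    using 1(3) shifts_commute[OF strands_pochhammer[OF order.refl, of a k t] strands_shuffle_nat[of r f], of e "e + k + a"]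
    unfolding T by simp_all
  have 7: "T6 * T8 = Y5 * Z3 * T6'"
    using arg_cong[OF B_natural_left[OF strands_pochhammer[OF order.refl, of a k t], of f], of "\<lambda>x. x \<up> e"]
    unfolding T T' Y Z by (simp add: B_add_left shift_mult add_ac)
  have 8: "T6' * T9 = Z4"
  proof -
    have "b + c - f = k + r" using r by simp
    then show ?thesis
      unfolding T T' Z by (simp add: pochhammer_add shift_mult)
  qed
  \<comment> \<open>The two rewriting phases are kept apart because \<open>T6\<close> and \<open>T3\<close> are interchanged in one direction by
    the first and in the other direction by the second.\<close>
  note stage1 = 1 2 3
  note stage2 = 4 5 6 7 8
  have "T1 * T2 * T3 * T4 * T5 * T6 * T7 * T8 * T9 = Z1 * Y1 * T2 * T5 * T6 * T3 * T7 * T8 * T9"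
    by (simp only: mult.assoc stage1[THEN mult_left_assoc] stage1)
  also have "\<dots> = Z1 * Z2 * (Y1 * Y2 * T3 * T7 * Y5) * Z3 * Z4"
    by (simp only: mult.assoc stage2[THEN mult_left_assoc] stage2)
  finally show ?thesis
    unfolding lhs rhs Z[symmetric]
    by (simp only: mult.assoc mult_left_assoc[OF scalar_central[of Z1]] mult_left_assoc[OF scalar_central[of Z2]])
qed

text \<open>The other composite gives \<open>(y\<^sub>1, x\<^sub>1 \<triangleleft> y\<^sub>2, w \<triangleleft> x\<^sub>2 y\<^sub>3)\<close>, and the factors around the summand of the
  Yetter--Drinfeld condition are the same as before.\<close>

lemma wrap_yd_right:
  assumes "j \<le> f" "j \<le> b" "f \<le> c + j"
  shows "unscaled_A t a b j * (unscaled_A t (a + b - j) (e + c) (f + e - j) \<up> j) * unscaled_A t j (f + e - j) e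
    = (S (int c) (int e) \<up> (a + b)) * B (a + b) e * (yd_right t b c f j \<up> (a + e)) * (B a f \<up> e)
      * (p t a (b + c - f) \<up> (e + f))"
proof -
  define n where "n = f - j"
  define u where "u = c - n"
  define d where "d = b - j"
  have f: "f = j + n" and c: "c = n + u" and b: "b = j + d" using assms by (auto simp: n_def u_def d_def)
  define R1 R2 R3 R4 R5 R6 R7 R8 R9
    where R: "R1 = S (int d) (int j) \<up> a" "R2 = (B a j :: braid \<Rightarrow>\<^sub>0 'k)" "R3 = p t a d \<up> j"
      "R4 = S (int u) (int (e + n)) \<up> (a + b)" "R5 = B (a + d) (e + n) \<up> j" "R6 = p t (a + d) u \<up> (e + f)"
      "R7 = S (int n) (int e) \<up> j" "R8 = (B j e :: braid \<Rightarrow>\<^sub>0 'k)" "R9 = p t j n \<up> e"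
  define Z1 Z2 Z3 Z4
    where Z: "Z1 = S (int c) (int e) \<up> (a + b)" "Z2 = (B (a + b) e :: braid \<Rightarrow>\<^sub>0 'k)"
      "Z3 = B a f \<up> e" "Z4 = p t a (b + c - f) \<up> (e + f)"
  define Y1 Y2 Y3 Y4
    where Y: "Y1 = S (int d) (int j) \<up> (a + e)" "Y2 = S (int u) (int n) \<up> (a + b + e)" "Y3 = B d n \<up> (j + a + e)"
      "Y4 = p t j n \<up> (a + e)"
  define R2' R3' R5' R7'
    where R': "R2' = B a j \<up> e" "R3' = p t a d \<up> (e + f)" "R5' = B a n \<up> (j + e)" "R7' = S (int n) (int e) \<up> (a + b)"
  have lhs: "unscaled_A t a b j * (unscaled_A t (a + b - j) (e + c) (f + e - j) \<up> j) * unscaled_A t j (f + e - j) e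
      = R1 * R2 * R3 * R4 * R5 * R6 * R7 * R8 * R9"
  proof -
    have "int b - int j = int d" "b - j = d" "a + b - j = a + d" "f + e - j = e + n"
      "int (e + c) - int (e + n) = int u" "e + c - (e + n) = u" "int (e + n) - int e = int n" "e + n - e = n"
      "a + d + j = a + b" "e + n + j = e + f"
      by (auto simp: b f c)
    then show ?thesis
      unfolding unscaled_A_def R by (simp only: shift_mult shift_shift mult.assoc)
  qed
  have rhs: "yd_right t b c f j \<up> (a + e) = Y1 * Y2 * Y3 * Y4"
  proof -
    have "int b - int j = int d" "b - j = d" "f - j = n" "int c + int j - int f = int u" "int f - int j = int n"
      by (auto simp: b f c)
    then show ?thesis
      unfolding yd_right_def Y by (simp only: shift_mult shift_shift mult.assoc add_ac)
  qed
  have 1: "R3 * R4 = R4 * R3"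
    using shifts_commute[OF strands_pochhammer[OF order.refl, of a d t] strands_shuffle_nat[of u "e + n"], of j "a + b"]
    unfolding R by (simp add: b)
  have 2: "R3 * R5 = R5 * R3'"
    using arg_cong[OF B_natural_left[OF strands_pochhammer[OF order.refl, of a d t], of "e + n"], of "\<lambda>x. x \<up> j"]
    unfolding R R' by (simp add: shift_mult f add_ac)
  have 3: "R3' * R6 = Z4"
  proof -
    have "b + c - f = d + u" by (simp add: b c f)
    then show ?thesis
      unfolding R R' Z by (simp add: pochhammer_add shift_mult)
  qed
  have 4: "Z4 * R7 = R7 * Z4" "Z4 * R8 = R8 * Z4" "Z4 * R9 = R9 * Z4"
    using shifts_commute[OF strands_shuffle_nat[of n e] strands_pochhammer[OF order.refl, of a "b + c - f" t], of j "e + f"]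
      shifts_commute[OF strands_B[OF order.refl, of j e] strands_pochhammer[OF order.refl, of a "b + c - f" t], of 0 "e + f"]
      shifts_commute[OF strands_pochhammer[OF order.refl, of j n t] strands_pochhammer[OF order.refl, of a "b + c - f" t], of e "e + f"]
    unfolding R Z by (simp_all add: f)
  have 5: "R5 * R7 = R7' * R5"
    using arg_cong[OF B_natural_right[OF strands_shuffle[of "int n" "int e" "e + n"], of "a + d"], of "\<lambda>x. x \<up> j"]
    unfolding R R' by (simp add: shift_mult b add_ac)
  have 6: "R4 * R7' = Z1 * Y2"
    using arg_cong[OF shuffle_coassoc[of u e n], of "\<lambda>x. x \<up> (a + b)"]
    unfolding R R' Z Y by (simp add: shift_mult c add_ac)
  have 7: "R5 * R8 = Z2 * Y3 * R5'"
  proof -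
    have "(B (a + d) n \<up> (j + e)) * R8 = R8 * (B (a + d) n \<up> (j + e))"
      using shifts_commute[OF strands_B[OF order.refl, of j e] strands_B[OF order.refl, of "a + d" n], of 0 "j + e"]
      unfolding R by simp
    moreover have "R5 = (B (a + d) e \<up> j) * (B (a + d) n \<up> (j + e))"
      unfolding R by (simp add: B_add_right shift_mult add_ac)
    moreover have "Z2 = (B (a + d) e \<up> j) * R8"
      using B_add_left[of j "a + d" e] unfolding R Z by (simp add: b add_ac)
    moreover have "B (a + d) n \<up> (j + e) = Y3 * R5'"
      using B_add_left[of a d n] unfolding Y R' by (simp add: shift_mult add_ac)
    ultimately show ?thesis by (simp add: mult.assoc)
  qed
  have 8: "Y2 * Z2 = Z2 * Y2"
    using shifts_commute[OF strands_B[OF order.refl, of "a + b" e] strands_shuffle_nat[of u n], of 0 "a + b + e"]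
    unfolding Y Z by simp
  have 9: "R2 * Z1 = Z1 * R2" "R1 * Z1 = Z1 * R1"
    using shifts_commute[OF strands_B[OF order.refl, of a j] strands_shuffle_nat[of c e], of 0 "a + b"]
      shifts_commute[OF strands_shuffle_nat[of d j] strands_shuffle_nat[of c e], of a "a + b"]
    unfolding R Z by (simp_all add: b)
  have 10: "R2 * Z2 = Z2 * R2'"
    unfolding R R' Z by (rule B_natural_left, rule strands_B) (simp add: b)
  have 11: "R1 * Z2 = Z2 * Y1"
    using B_natural_left[OF strands_shift[OF strands_shuffle_nat[of d j], of 0 a "a + b"], of e]
    unfolding R Y Z by (simp add: b)
  have 12: "R2' * Y2 = Y2 * R2'" "R2' * Y3 = Y3 * R2'"
    using shifts_commute[OF strands_B[OF order.refl, of a j] strands_shuffle_nat[of u n], of e "a + b + e"]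
      shifts_commute[OF strands_B[OF order.refl, of a j] strands_B[OF order.refl, of d n], of e "j + a + e"]
    unfolding R' Y by (simp_all add: b)
  have 13: "R2' * R5' = Z3"
    unfolding R' Z by (simp add: f B_add_right shift_mult)
  have 14: "Z3 * R9 = Y4 * Z3"
    using arg_cong[OF B_natural_right[OF strands_pochhammer[OF order.refl, of j n t], of a], of "\<lambda>x. x \<up> e"]
    unfolding R Y Z by (simp add: shift_mult f)
  note stage1 = 1 2 3 4 5 6
  note stage2 = 7 8 9 10 11 12 13 14
  have "R1 * R2 * R3 * R4 * R5 * R6 * R7 * R8 * R9 = R1 * R2 * Z1 * Y2 * R5 * R8 * R9 * Z4"
    by (simp only: mult.assoc stage1[THEN mult_left_assoc] stage1)
  also have "\<dots> = Z1 * Z2 * (Y1 * Y2 * Y3 * Y4) * Z3 * Z4"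
    by (simp only: mult.assoc stage2[THEN mult_left_assoc] stage2)
  finally show ?thesis
    unfolding lhs rhs Z[symmetric] .
qed

lemma collect_scalars:
  "(scalar x * X) * (scalar y * Y) * (scalar z * Z) = scalar (x * y * z) * (X * Y * Z)"
  for X Y Z :: "braid \<Rightarrow>\<^sub>0 'k"
  by (simp only: scalar_mult mult.assoc mult_left_assoc[OF scalar_central[of X]] mult_left_assoc[OF scalar_central[of Y]]
      scalar_central[of "scalar _"])

end

theorem mainTheorem1:
  fixes q :: "'k::field" and a b c e f :: nat
  assumes "q \<noteq> 0"
  shows "(\<Sum>i | int e \<le> int i \<and> int i \<le> min (int c) (int b + int c - int f).
            (A_elem q b c i \<up> a) * A_elem q a i e * (A_elem q (a + i - e) (b + c - i) f \<up> e))
       = (\<Sum>j | max 0 (int f + int e - int c) \<le> int j \<and> int j \<le> min (int f) (int b).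
            A_elem q a b j * (A_elem q (a + b - j) c (f + e - j) \<up> j) * A_elem q j (f + e - j) e)"
    (is "(\<Sum>i | ?I i. ?L i) = (\<Sum>j | ?J j. ?R j)")
proof (cases "e \<le> c")
  case False
  then have "{i. ?I i} = {}" "{j. ?J j} = {}" by auto
  then show ?thesis by (simp only: sum.empty)
next
  case True
  then obtain c' where c: "c = e + c'" using le_Suc_ex by blast
  define t where "t = q powi (- 2)"
  define \<kappa> where "\<kappa> = q powi (3 - 2 * int a - int b - int f - 2 * int e)"
  define wrap :: "(braid \<Rightarrow>\<^sub>0 'k) \<Rightarrow> (braid \<Rightarrow>\<^sub>0 'k)" where
    "wrap x = scalar \<kappa> * ((shuffle_elem (int c') (int e) \<up> (a + b)) * of_braid (beta (a + b) e) * (x \<up> (a + e))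
      * (of_braid (beta a f) \<up> e) * (pochhammer_elem a (b + c' - f) 1 t \<up> (e + f)))" for x
  have wrap_sum: "wrap (\<Sum>i\<in>I. g i) = (\<Sum>i\<in>I. wrap (g i))" for I :: "nat set" and g
    by (simp add: wrap_def shift_sum sum_distrib_left sum_distrib_right)
  have wrap_zero: "wrap x = 0" if "x = 0" for x
    using that by (simp add: wrap_def)
  have L: "?L (e + k) = wrap (yd_left t b c' f k)" if "k \<le> c'" "k + f \<le> b + c'" for k
  proof -
    have tk: "t ^ k = q powi (- 2 * int k)"
      unfolding t_def by (simp only: power_int_mult power_int_of_nat)
    have "a + (e + k) - e = a + k" "b + (e + c') - (e + k) = b + c' - k" by simp_all
    moreover have "q powi (1 - int b - int (e + k)) * q powi (1 - int a - int e) * q powi (1 - int (a + k) - int f) = \<kappa> * t ^ k"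
      unfolding \<kappa>_def tk power_int_add[OF disjI1[OF assms], symmetric]
      by (rule arg_cong[of _ _ "(powi) q"]) simp
    ultimately have "?L (e + k) = scalar (\<kappa> * t ^ k)
        * ((unscaled_A t b (e + c') (e + k) \<up> a) * unscaled_A t a (e + k) e * (unscaled_A t (a + k) (b + c' - k) f \<up> e))"
      unfolding A_elem_eq_unscaled t_def[symmetric] c by (simp only: shift_mult shift_scalar collect_scalars)
    then show ?thesis
      unfolding scalar_mult mult.assoc[of "scalar \<kappa>"] wrap_yd_left[OF that] wrap_def .
  qed
  have R: "?R j = wrap (yd_right t b c' f j)" if "j \<le> f" "j \<le> b" "f \<le> c' + j" for j
  proof -
    have "q powi (1 - int a - int j) * q powi (1 - int (a + b - j) - int (f + e - j)) * q powi (1 - int j - int e) = \<kappa>"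
      unfolding \<kappa>_def power_int_add[OF disjI1[OF assms], symmetric]
      using that by (intro arg_cong[of _ _ "(powi) q"]) (simp add: of_nat_diff)
    then have "?R j = scalar \<kappa> * (unscaled_A t a b j * (unscaled_A t (a + b - j) (e + c') (f + e - j) \<up> j) * unscaled_A t j (f + e - j) e)"
      unfolding A_elem_eq_unscaled t_def[symmetric] c by (simp only: shift_mult shift_scalar collect_scalars)
    then show ?thesis
      unfolding wrap_yd_right[OF that] wrap_def .
  qed
  have "(\<Sum>i | ?I i. ?L i) = (\<Sum>k | k \<le> c' \<and> k + f \<le> b + c'. ?L (e + k))"
    by (rule sum.reindex_bij_witness[where i = "\<lambda>k. e + k" and j = "\<lambda>i. i - e"]) (auto simp: c)
  also have "\<dots> = (\<Sum>k | k \<le> c' \<and> k + f \<le> b + c'. wrap (yd_left t b c' f k))"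
    by (rule sum.cong) (use L in auto)
  also have "\<dots> = wrap (\<Sum>k\<le>c'. yd_left t b c' f k)"
    unfolding wrap_sum by (rule sum.mono_neutral_left) (auto intro!: wrap_zero yd_left_eq_0)
  also have "\<dots> = wrap (\<Sum>j\<le>f. yd_right t b c' f j)"
    by (simp only: yetter_drinfeld)
  also have "\<dots> = (\<Sum>j | ?J j. wrap (yd_right t b c' f j))"
    unfolding wrap_sum by (rule sum.mono_neutral_right) (auto simp: c intro!: wrap_zero yd_right_eq_0)
  also have "\<dots> = (\<Sum>j | ?J j. ?R j)"
    by (rule sum.cong) (use R in \<open>auto simp: c\<close>)
  finally show ?thesis .
qed

end
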